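(* The group $\Gamma(\square,\mathbb{O})$ of collineations of the (completed) octonionic affine plane that fix the points $(0,0)$, $(1,1)$, $(0)$ and $(\infty)$ is isomorphic to $\mathrm{Aut}(\mathbb{O})$. Therefore $\Gamma(\square,\mathbb{O})$ is isomorphic to $\mathrm{G}_{2(-14)}$, while in the case of the split octonions $\mathbb{O}_s$ the corresponding group $\Gamma(\square,\mathbb{O}_s)$ is isomorphic to $\mathrm{G}_{2(2)}$.
   Context: $\mathbb{O}$ is the real division algebra of octonions and $\mathbb{O}_s$ the real algebra of split octonions. For $K=\mathbb{O}$ or $K=\mathbb{O}_s$, the completed affine plane over $K$ has as points the pairs $(x,y)\in K^2$, the points at infinity $(s)$ for $s\in K$, and the point $(\infty)$. Its lines are: $[s,t]=\{(x,sx+t):x\in K\}\cup\{(s)\}$ for $s,t\in K$; the vertical lines $[c]=\{(c,y):y\in K\}\cup\{(\infty)\}$ for $c\in K$; and the line at infinity $[\infty]=\{(s):s\in K\}\cup\{(\infty)\}$. A collineation is a bijection of the set of points onto itself that maps lines onto lines. $\square=\{(0,0),(1,1),(0),(\infty)\}$, and $\Gamma(\square,K)$ denotes the group of collineations of the completed affine plane over $K$ fixing every point of $\square$. $\mathrm{Aut}(K)$ is the group of algebra automorphisms of $K$. $\mathrm{G}_{2(-14)}$ is the compact real form of the exceptional Lie group $\mathrm{G}_2$ and $\mathrm{G}_{2(2)}$ is the split (non-compact) real form; one has the known identifications $\mathrm{Aut}(\mathbb{O})=\mathrm{G}_{2(-14)}$ and $\mathrm{Aut}(\mathbb{O}_s)=\mathrm{G}_{2(2)}$.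 *)

theory Defs
  imports "HOL-Analysis.Analysis" "HOL-Algebra.Bij"
begin

section \<open>Quaternions, octonions and split octonions\<close>

text \<open>
  All three algebras are Cayley--Dickson doubles, with product
  \<open>(a, b) (c, d) = (a c + \<epsilon> d* b, d a + b c*)\<close>: the quaternions are the double of the
  complex numbers with \<open>\<epsilon> = -1\<close>; the octonions and the split octonions are the doubles
  of the quaternions with \<open>\<epsilon> = -1\<close> and \<open>\<epsilon> = 1\<close>, respectively.
\<close>

datatype quaternion = Quat complex complex

instantiation quaternion :: "{real_vector, one, times}"
begin

definition zero_quaternion :: quaternion where "0 = Quat 0 0"

definition one_quaternion :: quaternion where "1 = Quat 1 0"

fun plus_quaternion :: "quaternion \<Rightarrow> quaternion \<Rightarrow> quaternion" where
  "Quat a b + Quat c d = Quat (a + c) (b + d)"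

fun uminus_quaternion :: "quaternion \<Rightarrow> quaternion" where
  "- Quat a b = Quat (- a) (- b)"

fun minus_quaternion :: "quaternion \<Rightarrow> quaternion \<Rightarrow> quaternion" where
  "Quat a b - Quat c d = Quat (a - c) (b - d)"

fun scaleR_quaternion :: "real \<Rightarrow> quaternion \<Rightarrow> quaternion" where
  "r *\<^sub>R Quat a b = Quat (r *\<^sub>R a) (r *\<^sub>R b)"

fun times_quaternion :: "quaternion \<Rightarrow> quaternion \<Rightarrow> quaternion" where
  "Quat a b * Quat c d = Quat (a * c - cnj d * b) (d * a + b * cnj c)"

instance
proof
  fix x y z :: quaternion and r s :: real
  show "x + y + z = x + (y + z)" by (cases x; cases y; cases z) (simp add: add.assoc)
  show "x + y = y + x" by (cases x; cases y) (simp add: add.commute)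
  show "0 + x = x" by (cases x) (simp add: zero_quaternion_def)
  show "- x + x = 0" by (cases x) (simp add: zero_quaternion_def)
  show "x - y = x + - y" by (cases x; cases y) simp
  show "r *\<^sub>R (x + y) = r *\<^sub>R x + r *\<^sub>R y"
    by (cases x; cases y) (simp add: scaleR_add_right)
  show "(r + s) *\<^sub>R x = r *\<^sub>R x + s *\<^sub>R x" by (cases x) (simp add: scaleR_add_left)
  show "r *\<^sub>R s *\<^sub>R x = (r * s) *\<^sub>R x" by (cases x) simp
  show "1 *\<^sub>R x = x" by (cases x) simp
qed

end

fun qcnj :: "quaternion \<Rightarrow> quaternion" where
  "qcnj (Quat a b) = Quat (cnj a) (- b)"

datatype octonion = Oct quaternion quaternion

instantiation octonion :: "{real_vector, one, times}"
begin

definition zero_octonion :: octonion where "0 = Oct 0 0"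

definition one_octonion :: octonion where "1 = Oct 1 0"

fun plus_octonion :: "octonion \<Rightarrow> octonion \<Rightarrow> octonion" where
  "Oct a b + Oct c d = Oct (a + c) (b + d)"

fun uminus_octonion :: "octonion \<Rightarrow> octonion" where
  "- Oct a b = Oct (- a) (- b)"

fun minus_octonion :: "octonion \<Rightarrow> octonion \<Rightarrow> octonion" where
  "Oct a b - Oct c d = Oct (a - c) (b - d)"

fun scaleR_octonion :: "real \<Rightarrow> octonion \<Rightarrow> octonion" where
  "r *\<^sub>R Oct a b = Oct (r *\<^sub>R a) (r *\<^sub>R b)"

fun times_octonion :: "octonion \<Rightarrow> octonion \<Rightarrow> octonion" where
  "Oct a b * Oct c d = Oct (a * c - qcnj d * b) (d * a + b * qcnj c)"

instance
proof
  fix x y z :: octonion and r s :: real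
  show "x + y + z = x + (y + z)" by (cases x; cases y; cases z) (simp add: add.assoc)
  show "x + y = y + x" by (cases x; cases y) (simp add: add.commute)
  show "0 + x = x" by (cases x) (simp add: zero_octonion_def)
  show "- x + x = 0" by (cases x) (simp add: zero_octonion_def)
  show "x - y = x + - y" by (cases x; cases y) simp
  show "r *\<^sub>R (x + y) = r *\<^sub>R x + r *\<^sub>R y"
    by (cases x; cases y) (simp add: scaleR_add_right)
  show "(r + s) *\<^sub>R x = r *\<^sub>R x + s *\<^sub>R x" by (cases x) (simp add: scaleR_add_left)
  show "r *\<^sub>R s *\<^sub>R x = (r * s) *\<^sub>R x" by (cases x) simp
  show "1 *\<^sub>R x = x" by (cases x) simp
qed

end

datatype split_octonion = SOct quaternion quaternion

instantiation split_octonion :: "{real_vector, one, times}"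
begin

definition zero_split_octonion :: split_octonion where "0 = SOct 0 0"

definition one_split_octonion :: split_octonion where "1 = SOct 1 0"

fun plus_split_octonion :: "split_octonion \<Rightarrow> split_octonion \<Rightarrow> split_octonion" where
  "SOct a b + SOct c d = SOct (a + c) (b + d)"

fun uminus_split_octonion :: "split_octonion \<Rightarrow> split_octonion" where
  "- SOct a b = SOct (- a) (- b)"

fun minus_split_octonion :: "split_octonion \<Rightarrow> split_octonion \<Rightarrow> split_octonion" where
  "SOct a b - SOct c d = SOct (a - c) (b - d)"

fun scaleR_split_octonion :: "real \<Rightarrow> split_octonion \<Rightarrow> split_octonion" where
  "r *\<^sub>R SOct a b = SOct (r *\<^sub>R a) (r *\<^sub>R b)"

fun times_split_octonion :: "split_octonion \<Rightarrow> split_octonion \<Rightarrow> split_octonion" where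
  "SOct a b * SOct c d = SOct (a * c + qcnj d * b) (d * a + b * qcnj c)"

instance
proof
  fix x y z :: split_octonion and r s :: real
  show "x + y + z = x + (y + z)" by (cases x; cases y; cases z) (simp add: add.assoc)
  show "x + y = y + x" by (cases x; cases y) (simp add: add.commute)
  show "0 + x = x" by (cases x) (simp add: zero_split_octonion_def)
  show "- x + x = 0" by (cases x) (simp add: zero_split_octonion_def)
  show "x - y = x + - y" by (cases x; cases y) simp
  show "r *\<^sub>R (x + y) = r *\<^sub>R x + r *\<^sub>R y"
    by (cases x; cases y) (simp add: scaleR_add_right)
  show "(r + s) *\<^sub>R x = r *\<^sub>R x + s *\<^sub>R x" by (cases x) (simp add: scaleR_add_left)
  show "r *\<^sub>R s *\<^sub>R x = (r * s) *\<^sub>R x" by (cases x) simp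
  show "1 *\<^sub>R x = x" by (cases x) simp
qed

end

definition algebra_Aut :: "('a::{real_vector,times} \<Rightarrow> 'a) monoid" where
  "algebra_Aut = (BijGroup UNIV)
     \<lparr>carrier := {f \<in> Bij UNIV. linear f \<and> (\<forall>x y. f (x * y) = f x * f y)}\<rparr>"


section \<open>The completed affine plane\<close>

datatype 'a point = Affine 'a 'a | Slope 'a | Infinity

definition sloped_line :: "'a::{plus,times} \<Rightarrow> 'a \<Rightarrow> 'a point set" where
  "sloped_line s t = insert (Slope s) {Affine x (s * x + t) | x. True}"

definition vertical_line :: "'a \<Rightarrow> 'a point set" where
  "vertical_line c = insert Infinity {Affine c y | y. True}"

definition line_at_infinity :: "'a point set" where
  "line_at_infinity = insert Infinity (range Slope)"

definition plane_lines :: "'a::{plus,times} point set set" where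
  "plane_lines = {sloped_line s t | s t. True} \<union> range vertical_line \<union> {line_at_infinity}"

definition collineation :: "('a::{plus,times} point \<Rightarrow> 'a point) \<Rightarrow> bool" where
  "collineation f \<longleftrightarrow> bij f \<and> (\<forall>L \<in> plane_lines. f ` L \<in> plane_lines)"

definition square :: "'a::{zero,one} point set" where
  "square = {Affine 0 0, Affine 1 1, Slope 0, Infinity}"

definition Gamma_square :: "('a::{zero,one,plus,times} point \<Rightarrow> 'a point) monoid" where
  "Gamma_square = (BijGroup UNIV)
     \<lparr>carrier := {f \<in> Bij UNIV. collineation f \<and> (\<forall>p \<in> square. f p = p)}\<rparr>"


section \<open>The exceptional Lie group of type G2 and its two real forms\<close>

definition wedge3 :: "'n \<Rightarrow> 'n \<Rightarrow> 'n \<Rightarrow> complex^'n \<Rightarrow> complex^'n \<Rightarrow> complex^'n \<Rightarrow> complex" where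
  "wedge3 i j k x y z =
     det (vector [vector [x$i, x$j, x$k], vector [y$i, y$j, y$k], vector [z$i, z$j, z$k]]
       :: complex^3^3)"

text \<open>
  The classical generic alternating 3-form on complex 7-space (in the normalisation of Bryant).
  The index type \<open>7\<close> has the elements \<open>1, \<dots>, 6\<close> and \<open>7 = 0\<close>.
\<close>

definition G2_form :: "complex^7 \<Rightarrow> complex^7 \<Rightarrow> complex^7 \<Rightarrow> complex" where
  "G2_form x y z =
     wedge3 1 2 3 x y z + wedge3 1 4 5 x y z + wedge3 1 6 7 x y z + wedge3 2 4 6 x y z
     - wedge3 2 5 7 x y z - wedge3 3 4 7 x y z - wedge3 3 5 6 x y z"

text \<open>
  The complex Lie group of type G2, in its 7-dimensional representation, as the stabiliser of
  the generic 3-form (Engel). The determinant condition is needed: the stabiliser of the form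
  in the full linear group also contains the scalar matrices given by the cube roots of unity.
\<close>

definition G2_complex :: "(complex^7^7) monoid" where
  "G2_complex =
     \<lparr>carrier = {A. det A = 1 \<and>
        (\<forall>x y z. G2_form (A *v x) (A *v y) (A *v z) = G2_form x y z)},
      mult = (**), one = mat 1\<rparr>"

text \<open>
  A real form is the group of fixed points of an antiholomorphic involutive automorphism.
  Entrywise conjugation gives the compact form, since the real matrices in \<open>G2_complex\<close> are
  orthogonal. The diagonal matrix below lies in the compact form and has order 2, so that
  conjugation composed with it gives another real form. Its maximal compact subgroup, the
  centraliser of the diagonal matrix in the compact form, has dimension 6; hence the Killing
  form has character \<open>8 - 6 = 2\<close>, the rank, which is the split case.
\<close>

definition real_form :: "(complex^7^7 \<Rightarrow> complex^7^7) \<Rightarrow> (complex^7^7) monoid" where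
  "real_form \<sigma> = G2_complex\<lparr>carrier := {A \<in> carrier G2_complex. \<sigma> A = A}\<rparr>"

definition conj_matrix :: "complex^'n^'m \<Rightarrow> complex^'n^'m" where
  "conj_matrix A = (\<chi> i j. cnj (A $ i $ j))"

definition involution_matrix :: "complex^7^7" where
  "involution_matrix =
     (\<chi> i j. if i = j then (if i \<in> {1, 2, 3} then 1 else - 1) else 0)"

definition G2_compact :: "(complex^7^7) monoid" where
  "G2_compact = real_form conj_matrix"

definition G2_split :: "(complex^7^7) monoid" where
  "G2_split = real_form (\<lambda>A. involution_matrix ** conj_matrix A ** involution_matrix)"

end

theory Submission
  imports Defs
begin

text \<open>
  A collineation fixing the four points preserves the line at infinity, the vertical and the
  horizontal lines, hence has the form \<open>(x, y) \<mapsto> (a x, b y)\<close>, \<open>(s) \<mapsto> (c s)\<close>; the images of the lines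
  \<open>[s, t]\<close> give \<open>b (s x + t) = c s * a x + b t\<close>, so \<open>a = b = c\<close> is a ring automorphism. It maps the
  centre \<open>\<real>\<close> to itself, necessarily identically, and is therefore linear.

  For the comparison with matrices, both algebras are embedded in the complex octonions,
  written as \<open>\<complex> \<oplus> \<complex>\<^sup>7\<close> with the product given by the dot product and the cross product belonging to
  the 3-form. An automorphism fixes \<open>1\<close>, preserves the imaginary part, and so becomes a complex
  matrix preserving both products. Conversely, a matrix of determinant 1 preserving the 3-form
  maps null vectors \<open>e\<^sub>i \<plusminus> \<i> e\<^sub>j\<close> to null vectors, because these are the \<open>x\<close> for which the kernel of the
  2-form \<open>\<phi>(x, \<cdot>, \<cdot>)\<close> is larger than the line spanned by \<open>x\<close>. Hence it scales the quadratic form, and the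
  factor is 1. Finally, an automorphism has determinant 1 since it fixes the antisymmetrisation of
  \<open>x\<^sub>1 (x\<^sub>2 (\<dots> x\<^sub>7))\<close>, whose scalar part is a nonzero multiple of the determinant.
\<close>

section \<open>The cross product on complex 7-space\<close>

lemma exhaust_7: "x = 1 \<or> x = 2 \<or> x = 3 \<or> x = 4 \<or> x = 5 \<or> x = 6 \<or> x = 7" for x :: 7
proof (induct x)
  case (of_int z)
  then have "0 \<le> z" and "z < 7" by simp_all
  then have "z = 0 \<or> z = 1 \<or> z = 2 \<or> z = 3 \<or> z = 4 \<or> z = 5 \<or> z = 6" by arith
  then show ?case by auto
qed

lemma forall_7: "(\<forall>i::7. P i) \<longleftrightarrow> P 1 \<and> P 2 \<and> P 3 \<and> P 4 \<and> P 5 \<and> P 6 \<and> P 7"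
  by (metis exhaust_7)

lemma UNIV_7: "(UNIV :: 7 set) = {1, 2, 3, 4, 5, 6, 7}"
  using exhaust_7 by auto

lemma sum_7: "sum f (UNIV :: 7 set) = f 1 + f 2 + f 3 + f 4 + f 5 + f 6 + f 7"
  unfolding UNIV_7 by (simp add: add.assoc)

lemma prod_7: "prod f (UNIV :: 7 set) = f 1 * f 2 * f 3 * f 4 * f 5 * f 6 * f 7"
  unfolding UNIV_7 by (simp add: mult.assoc)

section \<open>The cross product obtained from the 3-form\<close>

lemma wedge3_expand:
  "wedge3 i j k x y z =
     x$i * (y$j * z$k - y$k * z$j) - x$j * (y$i * z$k - y$k * z$i) + x$k * (y$i * z$j - y$j * z$i)"
  unfolding wedge3_def det_3 vector_3 by (simp add: algebra_simps)

text \<open>Complex bilinear rather than Hermitian, so that nonzero null vectors exist.\<close>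

definition dot :: "complex^'n \<Rightarrow> complex^'n \<Rightarrow> complex" where
  "dot x y = (\<Sum>i\<in>UNIV. x$i * y$i)"

text \<open>The 3-form with its last argument dualised by \<open>dot\<close>; see
  \<open>G2_form_cross7\<close>.\<close>

definition cross7 :: "complex^7 \<Rightarrow> complex^7 \<Rightarrow> complex^7" where
  "cross7 x y = (\<chi> k. G2_form x y (axis k 1))"

lemma cross7_nth:
  "cross7 x y $ 1 = x$2 * y$3 - x$3 * y$2 + x$4 * y$5 - x$5 * y$4 + x$6 * y$7 - x$7 * y$6"
  "cross7 x y $ 2 = x$3 * y$1 - x$1 * y$3 + x$4 * y$6 - x$6 * y$4 - x$5 * y$7 + x$7 * y$5"
  "cross7 x y $ 3 = x$1 * y$2 - x$2 * y$1 - x$4 * y$7 + x$7 * y$4 - x$5 * y$6 + x$6 * y$5"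
  "cross7 x y $ 4 = x$5 * y$1 - x$1 * y$5 + x$6 * y$2 - x$2 * y$6 - x$7 * y$3 + x$3 * y$7"
  "cross7 x y $ 5 = x$1 * y$4 - x$4 * y$1 - x$7 * y$2 + x$2 * y$7 - x$6 * y$3 + x$3 * y$6"
  "cross7 x y $ 6 = x$7 * y$1 - x$1 * y$7 + x$2 * y$4 - x$4 * y$2 - x$3 * y$5 + x$5 * y$3"
  "cross7 x y $ 7 = x$1 * y$6 - x$6 * y$1 - x$2 * y$5 + x$5 * y$2 - x$3 * y$4 + x$4 * y$3"
  by (simp_all add: cross7_def G2_form_def wedge3_expand axis_def)

lemma G2_form_cross7: "G2_form x y z = dot (cross7 x y) z"
  unfolding G2_form_def wedge3_expand dot_def sum_7 cross7_nth by (simp add: algebra_simps)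

lemma dot_commute: "dot x y = dot y x"
  by (simp add: dot_def mult.commute)

lemma dot_add_left: "dot (x + y) z = dot x z + dot y z"
  by (simp add: dot_def sum.distrib distrib_right)

lemma dot_add_right: "dot z (x + y) = dot z x + dot z y"
  by (simp add: dot_def sum.distrib distrib_left)

lemma dot_scale_left: "dot (c *s x) y = c * dot x y"
  by (simp add: dot_def sum_distrib_left mult.assoc)

lemma dot_scale_right: "dot x (c *s y) = c * dot x y"
  by (simp add: dot_def sum_distrib_left mult.left_commute)

lemma dot_axis: "dot x (axis i c) = x$i * c"
  by (simp add: dot_def axis_def if_distrib cong: if_cong)

lemma dot_ext: "(\<And>z. dot x z = dot y z) \<Longrightarrow> x = y"
  by (metis (no_types) dot_axis mult.right_neutral vec_eq_iff)

lemma dot_matrix: "dot (A *v x) y = dot x (transpose A *v y)"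
  unfolding dot_def matrix_vector_mult_def transpose_def
  by (simp add: sum_distrib_left sum_distrib_right ac_simps) (rule sum.swap)

lemma cross7_add_left: "cross7 (x + y) z = cross7 x z + cross7 y z"
  unfolding vec_eq_iff forall_7 cross7_nth vector_add_component by (simp add: algebra_simps)

lemma cross7_scale_left: "cross7 (c *s x) y = c *s cross7 x y"
  unfolding vec_eq_iff forall_7 cross7_nth vector_smult_component by (simp add: algebra_simps)

lemma cross7_anticommute: "cross7 y x = - cross7 x y"
  unfolding vec_eq_iff forall_7 cross7_nth vector_uminus_component by (simp add: algebra_simps)

lemma cross7_add_right: "cross7 z (x + y) = cross7 z x + cross7 z y"
  unfolding vec_eq_iff forall_7 cross7_nth vector_add_component by (simp add: algebra_simps)

lemma cross7_scale_right: "cross7 x (c *s y) = c *s cross7 x y"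
  unfolding vec_eq_iff forall_7 cross7_nth vector_smult_component by (simp add: algebra_simps)

text \<open>This encodes the left alternative law \<open>x (x y) = (x x) y\<close> for imaginary
  bioctonions; it is checked in coordinates.\<close>

lemma cross7_cross7: "cross7 x (cross7 x y) = dot x y *s x - dot x x *s y"
  unfolding vec_eq_iff forall_7 cross7_nth vector_minus_component vector_smult_component dot_def sum_7
  by (simp add: algebra_simps)


section \<open>The complex group preserves the quadratic form\<close>

lemma ex_7: "(\<exists>i::7. P i) \<longleftrightarrow> P 1 \<or> P 2 \<or> P 3 \<or> P 4 \<or> P 5 \<or> P 6 \<or> P 7"
  by (metis exhaust_7)

text \<open>In the Fano plane the product of two distinct basis vectors is, up to sign, the third
  basis vector on their line; any \<open>k\<close> off that line will do.\<close>

lemma ex_off_line: "\<exists>k. k \<noteq> i \<and> k \<noteq> j \<and> cross7 (axis i 1) (axis j 1) $ k = 0"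
proof -
  have "\<forall>i j. \<exists>k. k \<noteq> i \<and> k \<noteq> j \<and> cross7 (axis i 1) (axis j 1) $ k = 0"
    unfolding forall_7 ex_7 cross7_nth by (simp add: axis_def)
  then show ?thesis by blast
qed

lemma axis_eq_scale: "axis i c = c *s axis i (1::complex)"
  by (simp add: axis_def vec_eq_iff)

text \<open>
  For null \<open>x\<close>, the vector \<open>y = x \<times> e\<^sub>k\<close> satisfies \<open>x \<times> y = 0\<close> by \<open>cross7_cross7\<close>, and \<open>k\<close> can be chosen
  such that \<open>y\<close> is not a multiple of \<open>x\<close>. Both properties are inherited by \<open>A x\<close> and \<open>A y\<close>,
  and \<open>cross7_cross7\<close> for them shows that \<open>A x\<close> is null.
\<close>

lemma G2_complex_null:
  assumes A: "A \<in> carrier G2_complex" and ij: "i \<noteq> j" and c: "c * c = -1"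
  shows "dot (A *v (axis i 1 + c *s axis j 1)) (A *v (axis i 1 + c *s axis j 1)) = 0"
proof (rule ccontr)
  define x where "x = axis i 1 + c *s axis j (1::complex)"
  assume "\<not> ?thesis"
  then have q: "dot (A *v x) (A *v x) \<noteq> 0" by (simp add: x_def)
  have det: "det A = 1"
    and form: "\<And>x y z. dot (cross7 (A *v x) (A *v y)) (A *v z) = dot (cross7 x y) z"
    using A by (auto simp: G2_complex_def G2_form_cross7)
  obtain B where AB: "A ** B = mat 1" and BA: "B ** A = mat 1"
    using det invertible_det_nz[of A] by (auto simp: invertible_def)
  obtain k where k: "k \<noteq> i" "k \<noteq> j" "cross7 (axis i 1) (axis j 1) $ k = 0"
    using ex_off_line by blast
  define y where "y = cross7 x (axis k 1)"
  have xk: "dot x (axis k 1) = 0" and xx: "dot x x = 0"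
    using k ij c by (auto simp: x_def dot_axis dot_add_left dot_add_right dot_scale_left dot_scale_right)
      (auto simp: axis_def)
  have "cross7 x y = 0"
    by (simp add: y_def cross7_cross7 xk xx)
  then have "cross7 (A *v x) (A *v y) = 0"
  proof (intro dot_ext)
    fix z assume "cross7 x y = 0"
    have "z = A *v (B *v z)" by (simp add: AB matrix_vector_mul_assoc)
    then show "dot (cross7 (A *v x) (A *v y)) z = dot 0 z"
      using form[of x y "B *v z"] \<open>cross7 x y = 0\<close> by (simp add: dot_def)
  qed
  then have "dot (A *v x) (A *v y) *s (A *v x) = dot (A *v x) (A *v x) *s (A *v y)"
    using cross7_cross7[of "A *v x" "A *v y"] cross7_scale_right[of "A *v x" 0 0] by simp
  then have "A *v y = (dot (A *v x) (A *v y) / dot (A *v x) (A *v x)) *s (A *v x)"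
    using q by (simp add: vec_eq_iff field_simps)
  then obtain t where "A *v y = A *v (t *s x)"
    by (auto simp: vec.scale)
  then have yt: "y = t *s x"
    by (metis BA matrix_vector_mul_assoc matrix_vector_mul_lid)
  \<comment> \<open>Cyclic symmetry of the 3-form turns this coordinate into a multiple of the
    \<open>k\<close>-th coordinate of \<open>e_i \<times> e_j\<close>, which vanishes by the choice
    of \<open>k\<close>. As \<open>x $ i = 1\<close>, the factor \<open>t\<close> is 0.\<close>
  have "y $ i = dot (cross7 x (axis k 1)) (axis i 1)"
    by (simp add: y_def dot_axis)
  also have "\<dots> = dot (cross7 (axis i 1) x) (axis k 1)"
    unfolding G2_form_cross7[symmetric] G2_form_def wedge3_expand by (simp add: algebra_simps)
  also have "\<dots> = c * cross7 (axis i 1) (axis j 1) $ k + cross7 (axis i 1) (axis i 1) $ k"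
    by (simp add: x_def dot_axis cross7_add_right cross7_scale_right)
  also have "\<dots> = 0"
    using k cross7_anticommute[of "axis i 1" "axis i 1"] by (simp add: vec_eq_iff)
  finally have "t = 0" 
    using yt ij by (simp add: x_def axis_def)
  then have "cross7 x (axis k 1) = 0"
    using yt by (simp add: y_def)
  then have "cross7 (axis k 1) x = 0"
    using cross7_anticommute by (metis neg_equal_0_iff_equal)
  \<comment> \<open>The double cross product with \<open>e_k\<close> returns \<open>-x\<close>,
    because \<open>x\<close> is orthogonal to \<open>e_k\<close>.\<close>
  then have "dot (axis k 1) x *s axis k 1 - dot (axis k 1) (axis k 1) *s x = 0"
    by (metis cross7_cross7 cross7_scale_right vector_smult_lzero)
  then have "x = 0"
    using xk by (simp add: dot_commute dot_axis)
  then have "x $ i = 0" by simp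
  then show False using ij by (simp add: x_def axis_def)
qed

lemma matrix_vector_mult_minus: "A *v (- x) = - (A *v (x :: 'a::ring_1^'n))"
  by (simp add: vec_eq_iff matrix_vector_mult_def sum_negf)

lemma matrix_vector_mult_axis: "(A *v axis j 1) $ i = (A $ i $ j :: 'a::semiring_1)"
  by (simp add: matrix_vector_mult_def axis_def if_distrib[of "\<lambda>a. _ * a"] cong: if_cong)

lemma transpose_mult_nth: "(transpose A ** A) $ i $ j = dot (A *v axis i 1) (A *v axis j 1)"
  by (simp add: dot_def matrix_matrix_mult_def transpose_def matrix_vector_mult_axis)

text \<open>The null vectors determine the quadratic form up to a factor: by
  \<open>G2_complex_null\<close> the Gram matrix \<open>P\<close> of the columns of \<open>A\<close>
  is scalar. Two different powers of this scalar equal 1, with coprime exponents.\<close>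

lemma G2_complex_orthogonal:
  assumes A: "A \<in> carrier G2_complex"
  shows "transpose A ** A = mat 1"
    and "cross7 (A *v x) (A *v y) = A *v cross7 x y"
proof -
  have det: "det A = 1"
    and form: "\<And>x y z. dot (cross7 (A *v x) (A *v y)) (A *v z) = dot (cross7 x y) z"
    using A by (auto simp: G2_complex_def G2_form_cross7)
  obtain B where AB: "A ** B = mat 1" and BA: "B ** A = mat 1"
    using det invertible_det_nz[of A] by (auto simp: invertible_def)
  define P where "P i j = dot (A *v axis i 1) (A *v axis j 1)" for i j
  have PP: "P i i - P j j + 2 * c * P i j = 0" if "i \<noteq> j" "c * c = -1" for i j c
  proof -
    have "P i i + c * c * P j j + c * P i j + c * P j i = 0"
      using G2_complex_null[OF A that]
      by (simp add: P_def matrix_vector_right_distrib vec.scale dot_add_left dot_add_right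
          dot_scale_left dot_scale_right algebra_simps)
    moreover have "P j i = P i j" by (simp add: P_def dot_commute)
    ultimately show ?thesis using that by (simp add: algebra_simps)
  qed
  \<comment> \<open>The two square roots of -1 give two equations; their sum and difference separate
    the diagonal part from \<open>P i j\<close>.\<close>
  have P0: "P i j = 0 \<and> P i i = P j j" if "i \<noteq> j" for i j
  proof -
    have "P i i - P j j + 2 * \<i> * P i j = 0" "P i i - P j j - 2 * \<i> * P i j = 0"
      using PP[OF that, of \<i>] PP[OF that, of "-\<i>"] by simp_all
    then show ?thesis by (simp add: algebra_simps)
  qed
  define l where "l = P 1 1"
  \<comment> \<open>The determinant gives \<open>l\<^sup>7 = 1\<close> and the cross product gives \<open>l\<^sup>3 = 1\<close>.\<close>
  have TA: "transpose A ** A = mat l"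
    unfolding vec_eq_iff transpose_mult_nth P_def[symmetric]
    using P0 by (simp add: mat_def l_def) metis
  have "det (transpose A ** A) = 1"
    using det by (simp add: det_mul)
  moreover have "det (mat l :: complex^7^7) = l ^ 7"
    by (subst det_diagonal) (auto simp: mat_def prod_7 power_numeral_reduce)
  ultimately have l7: "l ^ 7 = 1"
    by (simp add: TA)
  have "mat l *v x = l *s x" for x :: "complex^7"
    by (simp add: vec_eq_iff matrix_vector_mult_def mat_def if_distrib[of "\<lambda>a. a * _"] cong: if_cong)
  then have dot: "dot (A *v x) (A *v y) = l * dot x y" for x y
    by (metis TA dot_commute dot_matrix dot_scale_left matrix_vector_mul_assoc)
  \<comment> \<open>Invariance of the 3-form relates the cross product to \<open>dot\<close>, and
    \<open>dot\<close> is scaled by \<open>l\<close>; hence the factor \<open>l\<close>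
    here.\<close>
  have cr: "A *v cross7 x y = l *s cross7 (A *v x) (A *v y)" for x y
  proof (rule dot_ext)
    fix z
    have "dot (A *v cross7 x y) z = dot (A *v cross7 x y) (A *v (B *v z))"
      by (simp add: AB matrix_vector_mul_assoc)
    also have "\<dots> = l * dot (cross7 (A *v x) (A *v y)) (A *v (B *v z))"
      by (simp only: dot form)
    also have "\<dots> = dot (l *s cross7 (A *v x) (A *v y)) z"
      by (simp add: AB matrix_vector_mul_assoc dot_scale_left)
    finally show "dot (A *v cross7 x y) z = dot (l *s cross7 (A *v x) (A *v y)) z" .
  qed
  \<comment> \<open>For orthonormal \<open>x\<close>, \<open>y\<close> the double product
    \<open>x \<times> (x \<times> y)\<close> is \<open>-y\<close>. Applying \<open>A\<close> gives
    one factor \<open>l\<close> for each cross product and one for \<open>dot x x\<close>.\<close>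
  have "l ^ 3 = 1"
  proof -
    define x y :: "complex^7" where "x = axis 1 1" and "y = axis 2 1"
    have xy: "dot x y = 0" "dot x x = 1" by (simp_all add: x_def y_def dot_axis) (simp_all add: axis_def)
    have "A *v cross7 x (cross7 x y) = - (A *v y)"
      by (simp add: cross7_cross7 xy matrix_vector_mult_minus)
    moreover have "A *v cross7 x (cross7 x y) = - (l ^ 3 *s (A *v y))"
      unfolding cr cross7_scale_right unfolding cross7_cross7 dot xy
      by (simp add: vec_eq_iff power3_eq_cube)
    ultimately have "A *v y = A *v (l ^ 3 *s y)"
      by (simp add: vec.scale)
    then have "y = l ^ 3 *s y"
      by (metis BA matrix_vector_mul_assoc matrix_vector_mul_lid)
    then have "y $ 2 = l ^ 3 * y $ 2" by (metis vector_smult_component)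
    then show ?thesis by (simp add: y_def)
  qed
  moreover have "l ^ 7 = l ^ 3 * l ^ 3 * l" by (simp add: power_numeral_reduce)
  ultimately have "l = 1" using l7 by simp
  then show "transpose A ** A = mat 1" "cross7 (A *v x) (A *v y) = A *v cross7 x y"
    using TA cr by simp_all
qed


section \<open>The determinant of an automorphism\<close>

text \<open>Antisymmetrising a tensor makes \<open>A\<close> act on it by the determinant. After the
  sums are exchanged, the coefficient of \<open>T k\<close> is the determinant of \<open>A\<close>
  with its rows selected by \<open>k\<close>: zero unless \<open>k\<close> is a permutation, and
  otherwise \<open>sign k * det A\<close>.\<close>

lemma det_invariant_tensor:
  fixes A :: "'a::comm_ring_1^'n^'n" and T :: "('n \<Rightarrow> 'n) \<Rightarrow> 'a"
  assumes T: "\<And>p. p permutes UNIV \<Longrightarrow> T p = (\<Sum>k\<in>UNIV. (\<Prod>m\<in>UNIV. A $ k m $ p m) * T k)"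
  shows "(\<Sum>p | p permutes UNIV. of_int (sign p) * T p) =
    det A * (\<Sum>p | p permutes UNIV. of_int (sign p) * T p)"
proof -
  have "(\<Sum>p | p permutes UNIV. of_int (sign p) * T p) =
      (\<Sum>p | p permutes UNIV. \<Sum>k\<in>UNIV. of_int (sign p) * ((\<Prod>m\<in>UNIV. A $ k m $ p m) * T k))"
    by (intro sum.cong) (simp_all add: T flip: sum_distrib_left)
  also have "\<dots> = (\<Sum>k\<in>UNIV. det (\<chi> m. A $ k m) * T k)"
    by (subst sum.swap) (simp add: det_def sum_distrib_right mult.assoc)
  also have "\<dots> = (\<Sum>k | k permutes UNIV. det (\<chi> m. A $ k m) * T k)"
  proof (rule sum.mono_neutral_right)
    show "\<forall>k \<in> UNIV - {k. k permutes UNIV}. det (\<chi> m. A $ k m) * T k = 0"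
    proof
      fix k :: "'n \<Rightarrow> 'n" assume "k \<in> UNIV - {k. k permutes UNIV}"
      then have "\<not> bij k" using bij_imp_permutes[of k UNIV] by auto
      then have "\<not> inj k" by (simp add: bij_def finite_UNIV_inj_surj)
      then obtain i j where "i \<noteq> j" "k i = k j" by (auto simp: inj_def)
      then have "det (\<chi> m. A $ k m) = 0"
        by (intro det_identical_rows[of i j]) (simp_all add: row_def)
      then show "det (\<chi> m. A $ k m) * T k = 0" by simp
    qed
  qed auto
  also have "\<dots> = (\<Sum>k | k permutes UNIV. det A * (of_int (sign k) * T k))"
    by (intro sum.cong) (simp_all add: det_permute_rows)
  also have "\<dots> = det A * (\<Sum>p | p permutes UNIV. of_int (sign p) * T p)"
    by (rule sum_distrib_left[symmetric])
  finally show ?thesis .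
qed

text \<open>
  Pairs \<open>(a, v)\<close> represent bioctonions with real part \<open>a\<close> and imaginary part \<open>v\<close>; \<open>lmul x\<close> is the
  left multiplication by the imaginary bioctonion \<open>x\<close>.
\<close>

definition lmul :: "complex^7 \<Rightarrow> complex \<times> (complex^7) \<Rightarrow> complex \<times> (complex^7)" where
  "lmul x w = (- dot x (snd w), fst w *s x + cross7 x (snd w))"

definition pscale :: "complex \<Rightarrow> complex \<times> (complex^7) \<Rightarrow> complex \<times> (complex^7)" where
  "pscale c w = (c * fst w, c *s snd w)"

lemma lmul_add_left: "lmul (x + y) w = lmul x w + lmul y w"
  by (simp add: lmul_def dot_add_left cross7_add_left vector_add_ldistrib algebra_simps)

lemma lmul_scale_left: "lmul (c *s x) w = pscale c (lmul x w)"
  by (simp add: lmul_def pscale_def dot_scale_left cross7_scale_left vector_add_ldistrib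
      vector_smult_assoc mult.commute)

lemma lmul_add_right: "lmul x (v + w) = lmul x v + lmul x w"
  by (simp add: lmul_def dot_add_right cross7_add_right vector_sadd_rdistrib algebra_simps)

lemma lmul_scale_right: "lmul x (pscale c w) = pscale c (lmul x w)"
  by (simp add: lmul_def pscale_def dot_scale_right cross7_scale_right vector_add_ldistrib
      vector_smult_assoc)

lemma lmul_sum_left: "finite S \<Longrightarrow> lmul (\<Sum>k\<in>S. c k *s f k) w = (\<Sum>k\<in>S. pscale (c k) (lmul (f k) w))"
proof (induction S rule: finite_induct)
  case empty
  then show ?case by (simp add: lmul_def dot_def cross7_scale_left[of 0, simplified] zero_prod_def)
qed (simp add: lmul_add_left lmul_scale_left)

lemma lmul_sum_right: "finite S \<Longrightarrow> lmul x (\<Sum>k\<in>S. pscale (c k) (f k)) = (\<Sum>k\<in>S. pscale (c k) (lmul x (f k)))"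
proof (induction S rule: finite_induct)
  case empty
  then show ?case by (simp add: lmul_def dot_def cross7_scale_right[of _ 0, simplified] zero_prod_def)
qed (simp add: lmul_add_right lmul_scale_right)

lemma pscale_sum: "pscale c (\<Sum>k\<in>S. f k) = (\<Sum>k\<in>S. pscale c (f k))"
  by (simp add: pscale_def prod_eq_iff sum_distrib_left fst_sum snd_sum vec.scale_sum_right)

lemma pscale_pscale: "pscale c (pscale d w) = pscale (c * d) w"
  by (simp add: pscale_def vector_smult_assoc)

lemma fst_pscale [simp]: "fst (pscale c w) = c * fst w"
  by (simp add: pscale_def)

lemma matrix_vector_mult_axis_sum: "A *v axis j 1 = (\<Sum>k\<in>UNIV. A $ k $ j *s axis k (1::'a::comm_ring_1))"
  unfolding vec_eq_iff matrix_vector_mult_axis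
  by (simp add: axis_def if_distrib[of "\<lambda>a. _ * a"] cong: if_cong)

text \<open>Multilinear expansion of a nested product. Distinct list entries allow the choices of
  basis vectors at the various positions to be recorded as one function on
  \<open>set ms\<close>.\<close>

lemma lmul_expand:
  assumes "distinct ms"
  shows "foldr lmul (map (\<lambda>m. A *v axis (p m) 1) ms) w =
    (\<Sum>k\<in>PiE (set ms) (\<lambda>_. UNIV). pscale (\<Prod>m\<in>set ms. A $ k m $ p m)
       (foldr lmul (map (\<lambda>m. axis (k m) 1) ms) w))"
  using assms
proof (induction ms)
  case Nil
  then show ?case by (simp add: pscale_def)
next
  case (Cons a ms)
  define h where "h k = pscale (\<Prod>m\<in>set (a # ms). A $ k m $ p m)
       (foldr lmul (map (\<lambda>m. axis (k m) 1) (a # ms)) w)" for k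
  have h: "h (g(a := y)) = pscale (A $ y $ p a) (pscale (\<Prod>m\<in>set ms. A $ g m $ p m)
      (lmul (axis y 1) (foldr lmul (map (\<lambda>m. axis (g m) 1) ms) w)))" for g y
  proof -
    have "(\<Prod>m\<in>set ms. A $ (g(a := y)) m $ p m) = (\<Prod>m\<in>set ms. A $ g m $ p m)"
      using Cons.prems by (intro prod.cong) auto
    moreover have "map (\<lambda>m. axis ((g(a := y)) m) 1) ms = map (\<lambda>m. axis (g m) (1::complex)) ms"
      using Cons.prems by auto
    ultimately show ?thesis using Cons.prems
      by (simp add: h_def pscale_pscale fun_upd_same del: fun_upd_apply map_eq_conv)
  qed
  have "foldr lmul (map (\<lambda>m. A *v axis (p m) 1) (a # ms)) w =
    (\<Sum>y\<in>UNIV. pscale (A $ y $ p a) (\<Sum>g\<in>PiE (set ms) (\<lambda>_. UNIV). pscale (\<Prod>m\<in>set ms. A $ g m $ p m)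
       (lmul (axis y 1) (foldr lmul (map (\<lambda>m. axis (g m) 1) ms) w))))"
    unfolding list.map foldr.simps comp_def matrix_vector_mult_axis_sum[of A "p a"] lmul_sum_left[OF finite]
    using Cons by (simp add: lmul_sum_right finite_PiE)
  also have "\<dots> = (\<Sum>y\<in>UNIV. \<Sum>g\<in>PiE (set ms) (\<lambda>_. UNIV). h (g(a := y)))"
    by (simp add: h pscale_sum)
  also have "\<dots> = (\<Sum>(y, g)\<in>UNIV \<times> PiE (set ms) (\<lambda>_. UNIV). h (g(a := y)))"
    by (rule sum.cartesian_product)
  \<comment> \<open>A function on the longer index set is a function on the shorter one together
    with a value at \<open>a\<close>.\<close>
  also have "\<dots> = sum h (PiE (set (a # ms)) (\<lambda>_. UNIV))"
    using sum.reindex[OF inj_combinator[of a "set ms" "\<lambda>_. UNIV"], of h] Cons.prems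
    by (simp add: PiE_insert_eq split_def o_def)
  finally show ?case by (simp add: h_def)
qed

section \<open>Clifford relations and the determinant\<close>

lemma cross7_cross7_polarised:
  "cross7 x (cross7 y z) + cross7 y (cross7 x z) = dot x z *s y + dot y z *s x - (2 * dot x y) *s z"
proof -
  have "cross7 (x + y) (cross7 (x + y) z) = dot (x + y) z *s (x + y) - dot (x + y) (x + y) *s z"
    by (rule cross7_cross7)
  then show ?thesis
    unfolding cross7_add_left cross7_add_right cross7_cross7 dot_add_left dot_add_right dot_commute[of y x]
    by (simp add: vec_eq_iff algebra_simps)
qed

text \<open>Linearising the left alternative law gives
  \<open>x (y w) + y (x w) = - 2 (dot x y) w\<close>, the relation of a Clifford algebra.\<close>

lemma lmul_anticommute:
  assumes "dot x y = 0"
  shows "lmul y (lmul x w) = - lmul x (lmul y w)"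
proof -
  have "dot y (cross7 x v) = - dot x (cross7 y v)" for v
    unfolding dot_commute[of x] dot_commute[of y] G2_form_cross7[symmetric] G2_form_def wedge3_expand
    by (simp add: algebra_simps)
  moreover have "cross7 y (cross7 x v) = dot x v *s y + dot y v *s x - cross7 x (cross7 y v)" for v
    using cross7_cross7_polarised[of x y v] assms by (simp add: algebra_simps)
  ultimately show ?thesis using assms
    by (simp add: lmul_def dot_add_right dot_scale_right dot_commute[of y x] cross7_add_right
        cross7_scale_right cross7_anticommute[of y x] vec_eq_iff algebra_simps)
qed

text \<open>
  Left multiplications by distinct basis vectors anticommute, so that \<open>clifford\<close> picks up the sign of
  a permutation. It is a replacement for the volume form whose invariance under \<open>A\<close> is
  immediate from the invariance of the product.
\<close>

definition clifford :: "(7 \<Rightarrow> 7) \<Rightarrow> complex \<times> (complex^7)" where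
  "clifford k = foldr lmul (map (\<lambda>m. axis (k m) 1) [1, 2, 3, 4, 5, 6, 7]) (1, 0)"

lemma lmul_minus: "lmul x (- w) = - lmul x w"
proof -
  have "pscale (- 1) v = - v" for v
    by (simp add: pscale_def prod_eq_iff)
  then show ?thesis using lmul_scale_right[of x "-1" w] by simp
qed

text \<open>An adjacent transposition exchanges two neighbouring anticommuting factors. Other
  transpositions follow from \<open>(a c) = (a b) (b c) (a b)\<close>, which contributes three sign
  changes; injectivity of \<open>k\<close> makes the factors orthogonal.\<close>

lemma clifford_transpose:
  assumes "inj k" "a \<noteq> b"
  shows "clifford (k \<circ> Transposition.transpose a b) = - clifford k"
proof -
  define Q where "Q a b \<longleftrightarrow> (\<forall>k. inj k \<longrightarrow> clifford (k \<circ> Transposition.transpose a b) = - clifford k)" for a b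
  have step: "Q a c" if "Q a b" "Q b c" "a \<noteq> b" "b \<noteq> c" "a \<noteq> c" for a b c
    unfolding Q_def
  proof (intro allI impI)
    fix k :: "7 \<Rightarrow> 7" assume k: "inj k"
    have eq: "Transposition.transpose a c =
        Transposition.transpose a b \<circ> Transposition.transpose b c \<circ> Transposition.transpose a b"
      using that by (auto simp: fun_eq_iff Transposition.transpose_def)
    show "clifford (k \<circ> Transposition.transpose a c) = - clifford k"
      using that k by (simp add: eq Q_def inj_compose flip: comp_assoc)
  qed
  have anti: "lmul (axis (k i) 1) (lmul (axis (k j) 1) w) = - lmul (axis (k j) 1) (lmul (axis (k i) 1) w)"
    if "inj k" "i \<noteq> j" for k :: "7 \<Rightarrow> 7" and i j w
    using that by (intro lmul_anticommute, unfold dot_axis) (simp add: axis_def inj_eq)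
  have "Q 1 2" unfolding Q_def clifford_def
    by (intro allI impI) (simp add: Transposition.transpose_def lmul_minus anti[where i=2 and j=1])
  note base = this
  have "Q 2 3" unfolding Q_def clifford_def
    by (intro allI impI) (simp add: Transposition.transpose_def lmul_minus anti[where i=3 and j=2])
  note base = base this
  have "Q 3 4" unfolding Q_def clifford_def
    by (intro allI impI) (simp add: Transposition.transpose_def lmul_minus anti[where i=4 and j=3])
  note base = base this
  have "Q 4 5" unfolding Q_def clifford_def
    by (intro allI impI) (simp add: Transposition.transpose_def lmul_minus anti[where i=5 and j=4])
  note base = base this
  have "Q 5 6" unfolding Q_def clifford_def
    by (intro allI impI) (simp add: Transposition.transpose_def lmul_minus anti[where i=6 and j=5])
  note base = base this
  have "Q 6 7" unfolding Q_def clifford_def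
    by (intro allI impI) (simp add: Transposition.transpose_def lmul_minus anti[where i=7 and j=6])
  note base = base this
  have Q_commute: "Q b a" if "Q a b" for a b
    using that by (simp add: Q_def transpose_commute)
  have "Q 1 3" "Q 2 4" "Q 3 5" "Q 4 6" "Q 5 7"
    using step[of 1 2 3] step[of 2 3 4] step[of 3 4 5] step[of 4 5 6] step[of 5 6 7] base by simp_all
  note base = base this
  have "Q 1 4" "Q 2 5" "Q 3 6" "Q 4 7"
    using step[of 1 2 4] step[of 2 3 5] step[of 3 4 6] step[of 4 5 7] base by simp_all
  note base = base this
  have "Q 1 5" "Q 2 6" "Q 3 7"
    using step[of 1 2 5] step[of 2 3 6] step[of 3 4 7] base by simp_all
  note base = base this
  have "Q 1 6" "Q 2 7"
    using step[of 1 2 6] step[of 2 3 7] base by simp_all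
  note base = base this
  have "Q 1 7"
    using step[of 1 2 7] base by simp_all
  note base = base this
  have "\<forall>a b. a \<noteq> b \<longrightarrow> Q a b"
    unfolding forall_7 using base base[THEN Q_commute] by simp
  then show ?thesis using assms by (simp add: Q_def)
qed

lemma clifford_permutes:
  assumes "p permutes UNIV"
  shows "clifford p = pscale (of_int (sign p)) (clifford id)"
  using finite assms
proof (induction rule: permutes_rev_induct)
  case id
  then show ?case by (simp add: pscale_def)
next
  case (swap a b p)
  have "inj p" using swap permutes_inj by blast
  then have "clifford (p \<circ> Transposition.transpose a b) = - pscale (of_int (sign p)) (clifford id)"
    using swap clifford_transpose[of p a b] by (simp only: not_False_eq_True)
  moreover have "sign (p \<circ> Transposition.transpose a b) = - sign p"
    using sign_compose[OF permutes_imp_permutation[OF finite \<open>p permutes UNIV\<close>] permutation_swap_id]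
      swap by (simp add: sign_swap_id)
  ultimately show ?case
    by (simp only:) (simp add: pscale_def prod_eq_iff id_def)
qed

text \<open>Evaluated from the right: \<open>e_6 e_7 = e_1\<close>, \<open>e_5 e_1 = e_4\<close>,
  \<open>e_4 e_4 = -1\<close>, \<open>e_2 e_3 = e_1\<close>, \<open>e_1 e_1 = -1\<close>, and the
  two signs cancel. The nonzero scalar part is what allows the determinant to be read off.\<close>

lemma clifford_id: "clifford id = (1, 0)"
proof -
  have c: "cross7 (axis 6 1) (axis 7 1) = axis 1 1" "cross7 (axis 5 1) (axis 1 1) = axis 4 1"
     "cross7 (axis 2 1) (axis 3 1) = axis 1 1"
    unfolding vec_eq_iff forall_7 cross7_nth by (simp_all add: axis_def)
  have z: "cross7 x 0 = 0" "cross7 x x = 0" for x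
    unfolding vec_eq_iff forall_7 cross7_nth by simp_all
  have d: "dot (axis i 1) (axis j 1) = (if i = j then 1 else 0)" for i j :: 7
    by (simp add: dot_axis) (simp add: axis_def)
  have l: "lmul (axis 7 1) (1, 0) = (0, axis 7 1)" "lmul (axis 6 1) (0, axis 7 1) = (0, axis 1 1)"
    "lmul (axis 5 1) (0, axis 1 1) = (0, axis 4 1)" "lmul (axis 4 1) (0, axis 4 1) = - (1, 0)"
    "lmul (axis 3 1) (1, 0) = (0, axis 3 1)" "lmul (axis 2 1) (0, axis 3 1) = (0, axis 1 1)"
    "lmul (axis 1 1) (0, axis 1 1) = - (1, 0)"
    by (simp_all add: lmul_def c z d) (simp_all add: dot_def)
  show ?thesis
    by (simp add: clifford_def l lmul_minus del: uminus_Pair)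
qed

text \<open>Invariance of the 3-form is immediate. For the determinant, \<open>A\<close> extended by
  the identity on scalars respects the product, so the scalar part of \<open>clifford\<close> is an
  invariant tensor to which \<open>det_invariant_tensor\<close> applies.\<close>

lemma G2_complexI:
  assumes dot: "\<And>x y. dot (A *v x) (A *v y) = dot x y"
    and cross: "\<And>x y. cross7 (A *v x) (A *v y) = A *v cross7 x y"
  shows "A \<in> carrier G2_complex"
proof -
  define T where "T k = fst (clifford k)" for k
  have lmul: "(fst (lmul x w), A *v snd (lmul x w)) = lmul (A *v x) (fst w, A *v snd w)" for x w
    by (simp add: lmul_def dot cross matrix_vector_right_distrib vec.scale)
  have fold: "foldr lmul (map (\<lambda>x. A *v x) xs) (fst w, A *v snd w) =
      (fst (foldr lmul xs w), A *v snd (foldr lmul xs w))" for xs w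
    by (induction xs) (simp_all add: lmul)
  have T: "T k = (\<Sum>q\<in>UNIV. (\<Prod>m\<in>UNIV. A $ q m $ k m) * T q)" for k
  proof -
    let ?ms = "[1, 2, 3, 4, 5, 6, 7] :: 7 list"
    have "T k = fst (foldr lmul (map (\<lambda>m. A *v axis (k m) 1) ?ms) (1, 0))"
      using fold[of "map (\<lambda>m. axis (k m) 1) ?ms" "(1, 0)"] by (simp add: T_def clifford_def)
    also have "foldr lmul (map (\<lambda>m. A *v axis (k m) 1) ?ms) (1, 0) =
        (\<Sum>q\<in>PiE (set ?ms) (\<lambda>_. UNIV). pscale (\<Prod>m\<in>set ?ms. A $ q m $ k m) (clifford q))"
      unfolding clifford_def by (rule lmul_expand) simp
    also have "set ?ms = UNIV" by (simp add: UNIV_7)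
    finally show ?thesis by (simp add: T_def fst_sum)
  qed
  \<comment> \<open>Each summand is the square of a sign, so the antisymmetrisation counts the
    permutations and is nonzero.\<close>
  have "(\<Sum>p | p permutes UNIV. of_int (sign p) * T p) = (\<Sum>p | p permutes (UNIV :: 7 set). 1)"
    by (intro sum.cong) (simp_all add: T_def clifford_permutes clifford_id flip: of_int_mult)
  also have "\<dots> = of_nat (card {p. p permutes (UNIV :: 7 set)})"
    by (simp only: sum_constant mult_1_right)
  also have "\<dots> = fact 7"
    by (simp only: card_permutations[OF refl finite] card_bit1 card_num1) simp
  finally have "det A * fact 7 = fact 7"
    using det_invariant_tensor[of T A, OF T] by metis
  then have "det A = 1"
    by (metis fact_nonzero mult_cancel_right1)
  then show ?thesis
    by (simp add: G2_complex_def G2_form_cross7 cross dot)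
qed


section \<open>Automorphisms of real forms of the bioctonions\<close>

text \<open>Nonnegative reals are squares, so \<open>g\<close> is monotone; it fixes the rationals,
  and density leaves no room elsewhere.\<close>

lemma real_endomorphism_id:
  fixes g :: "real \<Rightarrow> real"
  assumes add: "\<And>x y. g (x + y) = g x + g y" and mult: "\<And>x y. g (x * y) = g x * g y" and one: "g 1 = 1"
  shows "g x = x"
proof -
  interpret additive g by standard (rule add)
  have mono: "g x \<le> g y" if "x \<le> y" for x y
  proof -
    have "g y - g x = g (sqrt (y - x) * sqrt (y - x))"
      using that by (simp add: diff)
    then show ?thesis unfolding mult by (metis diff_ge_0_iff_ge zero_le_square)
  qed
  have nat: "g (of_nat n) = of_nat n" for n
    by (induction n) (simp_all add: zero add one)
  have int: "g (of_int k) = of_int k" for k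
    by (cases k rule: int_diff_cases) (simp add: diff nat)
  have rat: "g q = q" if "q \<in> \<rat>" for q
  proof -
    from that obtain a b where q: "q = of_int a / of_int b" and b: "b \<noteq> 0"
      by (elim Rats_cases') auto
    then have "g q * of_int b = of_int a"
      using mult[of q "of_int b"] int by simp
    then show ?thesis using q b by (metis nonzero_eq_divide_eq of_int_eq_0_iff)
  qed
  show ?thesis
  proof (rule ccontr)
    assume "g x \<noteq> x"
    then consider "g x < x" | "x < g x" by linarith
    then show False
    proof cases
      case 1
      then obtain q where "q \<in> \<rat>" "g x < q" "q < x" using Rats_dense_in_real by blast
      then show False using mono[of q x] rat[of q] by linarith
    next
      case 2
      then obtain q where "q \<in> \<rat>" "x < q" "q < g x" using Rats_dense_in_real by blast
      then show False using mono[of x q] rat[of q] by linarith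
    qed
  qed
qed

text \<open>The product of the bioctonions; \<open>lmul x\<close> is left multiplication by
  \<open>(0, x)\<close>.\<close>

definition omult :: "complex \<times> (complex^7) \<Rightarrow> complex \<times> (complex^7) \<Rightarrow> complex \<times> (complex^7)" where
  "omult v w = (fst v * fst w - dot (snd v) (snd w),
     fst v *s snd w + fst w *s snd v + cross7 (snd v) (snd w))"

text \<open>
  The image of \<open>emb\<close> is the real span of \<open>1\<close> and the vectors \<open>\<omega>\<^sub>i e\<^sub>i\<close>, a real form of the algebra
  of bioctonions.
\<close>

locale octonion_form =
  fixes emb :: "'a::{real_vector,one,times} \<Rightarrow> complex \<times> (complex^7)" and \<omega> :: "7 \<Rightarrow> complex"
  assumes inj_emb: "inj emb"
    and emb_add: "emb (x + y) = emb x + emb y"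
    and emb_scaleR: "emb (r *\<^sub>R x) = pscale (of_real r) (emb x)"
    and emb_one: "emb 1 = (1, 0)"
    and emb_mult: "emb (x * y) = omult (emb x) (emb y)"
    and range_emb: "range emb = {(a, v). a \<in> \<real> \<and> (\<forall>i. v $ i / \<omega> i \<in> \<real>)}"
    and \<omega>_nonzero: "\<omega> i \<noteq> 0"
    and \<omega>_square: "\<omega> i * \<omega> i \<in> \<real>"
begin

section \<open>Algebra laws inherited from the bioctonions\<close>

lemma emb_eqI: "emb x = emb y \<Longrightarrow> x = y"
  using inj_emb by (auto simp: inj_def)

lemma emb_zero: "emb 0 = 0"
  using emb_add[of 0 0] by simp

lemma alg_add_left: "(x + y) * z = x * z + y * (z::'a)"
  by (rule emb_eqI) (simp add: emb_mult emb_add omult_def dot_add_left cross7_add_left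
    vector_add_ldistrib vector_sadd_rdistrib algebra_simps)

lemma alg_add_right: "z * (x + y) = z * x + z * (y::'a)"
  by (rule emb_eqI) (simp add: emb_mult emb_add omult_def dot_add_right cross7_add_right
    vector_add_ldistrib vector_sadd_rdistrib algebra_simps)

lemma alg_scale_left: "(r *\<^sub>R x) * y = r *\<^sub>R (x * (y::'a))"
  by (rule emb_eqI) (simp add: emb_mult emb_scaleR omult_def pscale_def dot_scale_left cross7_scale_left
    vector_add_ldistrib vector_smult_assoc algebra_simps)

lemma alg_mult_one: "1 * x = x" "x * 1 = (x::'a)"
proof -
  have z: "cross7 v 0 = 0" "cross7 0 v = 0" "dot v 0 = 0" "dot 0 v = 0" for v
    using cross7_scale_left[of 0 0 v] cross7_scale_right[of v 0 0]
    by (simp_all add: dot_def)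
  show "1 * x = x" "x * 1 = x"
    by (rule emb_eqI, simp add: emb_mult emb_one omult_def z)+
qed

lemma alg_mult_zero: "0 * x = 0" "x * 0 = (0::'a)"
  using alg_add_left[of 0 0 x] alg_add_right[of x 0 0] by simp_all

definition form_real :: "complex^7 \<Rightarrow> bool" where
  "form_real v \<longleftrightarrow> (\<forall>i. v $ i / \<omega> i \<in> \<real>)"

text \<open>Meaningful for vectors with \<open>form_real\<close>, which are the imaginary parts of
  elements of the real form.\<close>

definition dec :: "complex^7 \<Rightarrow> 'a" where
  "dec v = inv_into UNIV emb (0, v)"

lemma emb_dec: "form_real v \<Longrightarrow> emb (dec v) = (0, v)"
  unfolding dec_def by (rule f_inv_into_f) (simp add: range_emb form_real_def)

lemma emb_real: "fst (emb x) \<in> \<real>" "form_real (snd (emb x))"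
  using range_emb rangeI[of emb x] by (auto simp: form_real_def)

lemma form_real_axis: "form_real (axis j (\<omega> j))"
  using \<omega>_nonzero by (simp add: form_real_def axis_def)

lemma emb_scale_one: "emb (r *\<^sub>R 1) = (of_real r, 0)"
  by (simp add: emb_scaleR emb_one pscale_def)

lemma real_im_decomposition: obtains r v where "form_real v" "x = r *\<^sub>R 1 + dec v"
proof -
  obtain r where r: "fst (emb x) = of_real r"
    using emb_real(1) by (auto elim: Reals_cases)
  have "x = r *\<^sub>R 1 + dec (snd (emb x))"
    by (rule emb_eqI) (simp add: emb_add emb_scale_one emb_dec[OF emb_real(2)] prod_eq_iff r)
  then show thesis using that emb_real(2) by blast
qed

text \<open>The vectors \<open>\<omega> j e_j\<close> form a complex basis, so complex linear
  identities extend from the real form to all vectors.\<close>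

lemma form_basis_induct:
  assumes "\<And>x y. P x \<Longrightarrow> P y \<Longrightarrow> P (x + y)" "\<And>c x. P x \<Longrightarrow> P (c *s x)" "\<And>j. P (axis j (\<omega> j))"
  shows "P (v :: complex^7)"
proof -
  have "P (\<Sum>j\<in>S. (v $ j / \<omega> j) *s axis j (\<omega> j))" if "finite S" for S
    using that
  proof (induction S)
    case empty
    then show ?case using assms(2)[OF assms(3), of 0] by simp
  qed (simp add: assms)
  moreover have "(\<Sum>j\<in>UNIV. (v $ j / \<omega> j) *s axis j (\<omega> j)) = v"
    using \<omega>_nonzero by (simp add: vec_eq_iff axis_def if_distrib[of "\<lambda>a. _ * a"] cong: if_cong)
  ultimately show ?thesis by (metis finite)
qed

lemma matrix_eqI_form_real: 
  assumes "\<And>v. form_real v \<Longrightarrow> A *v v = B *v v"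
  shows "A = (B :: complex^7^7)"
proof -
  have "A *v v = B *v v" for v
    by (rule form_basis_induct) (simp_all add: matrix_vector_right_distrib vec.scale assms form_real_axis)
  then show ?thesis by (simp add: matrix_eq)
qed

text \<open>The quotient is an entry of \<open>D^-1 A D\<close> with
  \<open>D = diag \<omega>\<close>, the matrix of \<open>A\<close> in the basis
  \<open>\<omega> j e_j\<close>. The condition thus says that \<open>A\<close> maps the real form to
  itself.\<close>

definition form_group :: "(complex^7^7) monoid" where
  "form_group = G2_complex\<lparr>carrier := {A \<in> carrier G2_complex. \<forall>i j. A $ i $ j * \<omega> j / \<omega> i \<in> \<real>}\<rparr>"

text \<open>The complex linear extension of the action on imaginary parts; the division passes from
  the basis \<open>\<omega> j e_j\<close> to \<open>e_j\<close>.\<close>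

definition im_matrix :: "('a \<Rightarrow> 'a) \<Rightarrow> complex^7^7" where
  "im_matrix f = (\<chi> i j. snd (emb (f (dec (axis j (\<omega> j))))) $ i / \<omega> j)"

lemma emb_sum: "emb (\<Sum>k\<in>S. h k) = (\<Sum>k\<in>S. emb (h k))"
  by (induction S rule: infinite_finite_induct) (simp_all add: emb_zero emb_add)

section \<open>From automorphisms to matrices\<close>

context
  fixes f :: "'a \<Rightarrow> 'a"
  assumes f: "f \<in> carrier algebra_Aut"
begin

lemma Aut_linear_mult_bij: "linear f" "f (x * y) = f x * f y" "bij f"
  using f by (auto simp: algebra_Aut_def Bij_def)

lemma Aut_one: "f 1 = 1"
  by (metis Aut_linear_mult_bij(2,3) alg_mult_one bij_pointE)

lemma Aut_scale_one: "f (r *\<^sub>R 1) = r *\<^sub>R 1"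
  by (simp add: Aut_linear_mult_bij(1) Aut_one linear_scale)

lemma dec_mult:
  assumes "form_real x" "form_real y"
  obtains r where "dec x * dec y = r *\<^sub>R 1 + dec (cross7 x y)" "dot x y = - of_real r"
    "form_real (cross7 x y)"
proof -
  have e: "emb (dec x * dec y) = (- dot x y, cross7 x y)"
    using assms by (simp add: emb_mult emb_dec omult_def)
  then have "- dot x y \<in> \<real>" and fr: "form_real (cross7 x y)"
    using emb_real[of "dec x * dec y"] by simp_all
  then obtain r where r: "- dot x y = of_real r" by (elim Reals_cases)
  have "dec x * dec y = r *\<^sub>R 1 + dec (cross7 x y)"
    by (rule emb_eqI) (simp add: e emb_add emb_scale_one emb_dec[OF fr] r)
  then show thesis using that r fr by (metis minus_minus)
qed

text \<open>The square of an imaginary element is real. If \<open>a + u\<close> has a real square,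
  then \<open>a u = 0\<close>, so it is imaginary or real; a real image is excluded, unless it is 0,
  because \<open>f\<close> is injective and fixes the reals.\<close>

lemma fst_aut_dec:
  assumes v: "form_real v"
  shows "fst (emb (f (dec v))) = 0"
proof -
  obtain r where r: "dec v * dec v = r *\<^sub>R 1 + dec (cross7 v v)"
    using dec_mult[OF v v] by blast
  have "cross7 v v = 0"
    using cross7_anticommute[of v v] by (simp add: vec_eq_iff)
  moreover have "dec 0 = 0"
    by (rule emb_eqI) (simp add: emb_dec form_real_def emb_zero zero_prod_def)
  ultimately have "f (dec v) * f (dec v) = r *\<^sub>R 1"
    using Aut_linear_mult_bij(2)[of "dec v" "dec v"] r Aut_scale_one by simp
  then have "omult (emb (f (dec v))) (emb (f (dec v))) = (of_real r, 0)"
    by (metis emb_mult emb_scale_one)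
  moreover have "cross7 w w = 0" for w
    using cross7_anticommute[of w w] by (simp add: vec_eq_iff)
  ultimately have "2 * fst (emb (f (dec v))) *s snd (emb (f (dec v))) = 0"
    by (simp add: omult_def vec_eq_iff algebra_simps)
  then consider "fst (emb (f (dec v))) = 0" | "snd (emb (f (dec v))) = 0"
    by (auto simp: vec_eq_iff)
  then show ?thesis
  proof cases
    case 2
    obtain a where a: "fst (emb (f (dec v))) = of_real a"
      using emb_real(1)[of "f (dec v)"] by (elim Reals_cases)
    have "f (dec v) = f (a *\<^sub>R 1)"
      by (rule emb_eqI) (simp add: Aut_scale_one emb_scale_one 2 a prod_eq_iff)
    then have "dec v = a *\<^sub>R 1"
      using Aut_linear_mult_bij(3) by (simp add: bij_def inj_eq)
    then have "(0, v) = (complex_of_real a, 0)"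
      using emb_dec[OF v] emb_scale_one by simp
    then show ?thesis using a by simp
  qed
qed

lemma emb_aut_dec:
  assumes v: "form_real v"
  shows "emb (f (dec v)) = (0, im_matrix f *v v)"
proof -
  \<comment> \<open>Coordinates in the basis \<open>\<omega> j e_j\<close> are real, so the merely
    real linear \<open>f\<close> can be applied termwise.\<close>
  define r where "r j = Re (v $ j / \<omega> j)" for j
  have r: "v $ j / \<omega> j = of_real (r j)" for j
    using v by (simp add: r_def form_real_def)
  have "dec v = (\<Sum>j\<in>UNIV. r j *\<^sub>R dec (axis j (\<omega> j)))"
  proof (rule emb_eqI)
    have "(\<Sum>j\<in>UNIV. of_real (r j) *s axis j (\<omega> j)) = v"
      using \<omega>_nonzero by (simp add: r[symmetric] vec_eq_iff axis_def if_distrib[of "\<lambda>a. _ * a"] cong: if_cong)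
    then show "emb (dec v) = emb (\<Sum>j\<in>UNIV. r j *\<^sub>R dec (axis j (\<omega> j)))"
      using v by (simp add: emb_dec emb_sum emb_scaleR form_real_axis pscale_def prod_eq_iff fst_sum snd_sum)
  qed
  then have "f (dec v) = (\<Sum>j\<in>UNIV. r j *\<^sub>R f (dec (axis j (\<omega> j))))"
    by (simp add: linear_sum[OF Aut_linear_mult_bij(1)] linear_scale[OF Aut_linear_mult_bij(1)])
  then have "snd (emb (f (dec v))) = (\<Sum>j\<in>UNIV. of_real (r j) *s snd (emb (f (dec (axis j (\<omega> j))))))"
    by (simp add: emb_sum emb_scaleR pscale_def snd_sum)
  also have "\<dots> = im_matrix f *v v"
    by (simp add: vec_eq_iff im_matrix_def matrix_vector_mult_def r[symmetric] mult.commute)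
  finally show ?thesis using fst_aut_dec[OF v] by (simp add: prod_eq_iff)
qed

lemma im_matrix_real: "im_matrix f $ i $ j * \<omega> j / \<omega> i \<in> \<real>"
proof -
  have "form_real (snd (emb (f (dec (axis j (\<omega> j))))))" by (rule emb_real)
  then show ?thesis using \<omega>_nonzero by (simp add: form_real_def im_matrix_def)
qed

text \<open>The product of two imaginary elements has real part \<open>- dot x y\<close> and
  imaginary part \<open>cross7 x y\<close>; both parts of \<open>f (x y) = f x f y\<close> are
  compared.\<close>

lemma im_matrix_preserves_real:
  assumes x: "form_real x" and y: "form_real y"
  shows "dot (im_matrix f *v x) (im_matrix f *v y) = dot x y"
    and "cross7 (im_matrix f *v x) (im_matrix f *v y) = im_matrix f *v cross7 x y"
proof -
  obtain r where r: "dec x * dec y = r *\<^sub>R 1 + dec (cross7 x y)" "dot x y = - of_real r"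
    "form_real (cross7 x y)"
    using dec_mult[OF assms] by blast
  have "f (dec x) * f (dec y) = r *\<^sub>R 1 + f (dec (cross7 x y))"
    by (metis Aut_scale_one Aut_linear_mult_bij(1,2) linear_add r(1))
  then have "emb (f (dec x) * f (dec y)) = emb (r *\<^sub>R 1 + f (dec (cross7 x y)))" by simp
  then have "- dot (im_matrix f *v x) (im_matrix f *v y) = of_real r"
    and "cross7 (im_matrix f *v x) (im_matrix f *v y) = im_matrix f *v cross7 x y"
    by (simp_all add: emb_mult emb_add emb_scale_one emb_aut_dec[OF x] emb_aut_dec[OF y]
       emb_aut_dec[OF r(3)] omult_def)
  then show "dot (im_matrix f *v x) (im_matrix f *v y) = dot x y"
    "cross7 (im_matrix f *v x) (im_matrix f *v y) = im_matrix f *v cross7 x y"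
    by (simp_all add: r(2) minus_equation_iff)
qed

text \<open>Both identities are complex bilinear, so they extend from the real form by induction
  over a basis in each argument in turn.\<close>

lemma im_matrix_in_form_group: "im_matrix f \<in> carrier form_group"
proof -
  let ?A = "im_matrix f"
  have dot: "dot (?A *v x) (?A *v y) = dot x y" for x y
  proof (rule form_basis_induct[where v=x])
    fix j
    show "dot (?A *v axis j (\<omega> j)) (?A *v y) = dot (axis j (\<omega> j)) y"
      by (rule form_basis_induct[where v=y])
        (simp_all add: matrix_vector_right_distrib vec.scale dot_add_right dot_scale_right
          im_matrix_preserves_real form_real_axis)
  qed (simp_all add: matrix_vector_right_distrib vec.scale dot_add_left dot_scale_left)
  have cross: "cross7 (?A *v x) (?A *v y) = ?A *v cross7 x y" for x y
  proof (rule form_basis_induct[where v=x])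
    fix j
    show "cross7 (?A *v axis j (\<omega> j)) (?A *v y) = ?A *v cross7 (axis j (\<omega> j)) y"
      by (rule form_basis_induct[where v=y])
        (simp_all add: matrix_vector_right_distrib vec.scale cross7_add_right cross7_scale_right
          im_matrix_preserves_real form_real_axis)
  qed (simp_all add: matrix_vector_right_distrib vec.scale cross7_add_left cross7_scale_left)
  show ?thesis
    using G2_complexI[of ?A] dot cross im_matrix_real by (simp add: form_group_def)
qed

end

section \<open>From matrices to automorphisms\<close>

lemma form_real_mult:
  assumes A: "\<And>i j. A $ i $ j * \<omega> j / \<omega> i \<in> \<real>" and v: "form_real v"
  shows "form_real (A *v v)"
  unfolding form_real_def
proof
  fix i
  have "(A *v v) $ i / \<omega> i = (\<Sum>j\<in>UNIV. (A $ i $ j * \<omega> j / \<omega> i) * (v $ j / \<omega> j))"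
    using \<omega>_nonzero by (simp add: matrix_vector_mult_def sum_divide_distrib)
  also have "\<dots> \<in> \<real>"
    using A v by (intro sum_in_Reals Reals_mult) (auto simp: form_real_def)
  finally show "(A *v v) $ i / \<omega> i \<in> \<real>" .
qed

definition aut_of_matrix :: "complex^7^7 \<Rightarrow> 'a \<Rightarrow> 'a" where
  "aut_of_matrix A x = inv_into UNIV emb (fst (emb x), A *v snd (emb x))"

lemma emb_aut_of_matrix:
  assumes "\<And>i j. A $ i $ j * \<omega> j / \<omega> i \<in> \<real>"
  shows "emb (aut_of_matrix A x) = (fst (emb x), A *v snd (emb x))"
  unfolding aut_of_matrix_def
  using form_real_mult[OF assms emb_real(2)] emb_real(1)
  by (intro f_inv_into_f) (simp add: range_emb form_real_def)

lemma aut_of_matrix_in_Aut: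
  assumes "A \<in> carrier form_group"
  shows "aut_of_matrix A \<in> carrier algebra_Aut"
proof -
  have G2: "A \<in> carrier G2_complex" and real: "\<And>i j. A $ i $ j * \<omega> j / \<omega> i \<in> \<real>"
    using assms by (auto simp: form_group_def)
  note e = emb_aut_of_matrix[OF real]
  note orth = G2_complex_orthogonal[OF G2]
  have dot: "dot (A *v x) (A *v y) = dot x y" for x y
    by (simp add: dot_matrix matrix_vector_mul_assoc dot_commute[of "A *v x"] orth(1) dot_commute)
  have lin: "linear (aut_of_matrix A)"
    by (rule linearI; rule emb_eqI)
      (simp_all add: e emb_add emb_scaleR matrix_vector_right_distrib vec.scale pscale_def)
  have mult: "aut_of_matrix A (x * y) = aut_of_matrix A x * aut_of_matrix A y" for x y
    by (rule emb_eqI) (simp add: e emb_mult omult_def dot orth(2) matrix_vector_right_distrib vec.scale)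
  \<comment> \<open>The transpose will serve as the inverse; it preserves the real form because the
    squares of the \<open>\<omega> i\<close> are real.\<close>
  have realT: "transpose A $ i $ j * \<omega> j / \<omega> i \<in> \<real>" for i j
  proof -
    have "transpose A $ i $ j * \<omega> j / \<omega> i = (A $ j $ i * \<omega> i / \<omega> j) * (\<omega> j * \<omega> j) / (\<omega> i * \<omega> i)"
      using \<omega>_nonzero by (simp add: transpose_def)
    also have "\<dots> \<in> \<real>"
      using real[of j i] \<omega>_square[of i] \<omega>_square[of j] Reals_mult Reals_divide by blast
    finally show ?thesis .
  qed
  note eT = emb_aut_of_matrix[OF realT]
  have AT: "A ** transpose A = mat 1"
    using orth(1) matrix_left_right_inverse by blast
  have "bij (aut_of_matrix A)"
  proof (rule o_bij)
    show "aut_of_matrix (transpose A) \<circ> aut_of_matrix A = id"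
      by (auto intro!: emb_eqI simp: fun_eq_iff e eT matrix_vector_mul_assoc orth(1))
    show "aut_of_matrix A \<circ> aut_of_matrix (transpose A) = id"
      by (auto intro!: emb_eqI simp: fun_eq_iff e eT matrix_vector_mul_assoc AT
          simp del: transpose_matrix_vector)
  qed
  then show ?thesis using lin mult by (simp add: algebra_Aut_def Bij_def)
qed

lemma im_matrix_aut_of_matrix:
  assumes "A \<in> carrier form_group"
  shows "im_matrix (aut_of_matrix A) = A"
proof (rule matrix_eqI_form_real)
  fix v assume v: "form_real v"
  have "\<And>i j. A $ i $ j * \<omega> j / \<omega> i \<in> \<real>" using assms by (auto simp: form_group_def)
  then have "emb (aut_of_matrix A (dec v)) = (0, A *v v)"
    by (simp add: emb_aut_of_matrix emb_dec v)
  then show "im_matrix (aut_of_matrix A) *v v = A *v v"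
    using emb_aut_dec[OF aut_of_matrix_in_Aut[OF assms] v] by simp
qed

lemma aut_of_matrix_im_matrix:
  assumes f: "f \<in> carrier algebra_Aut"
  shows "aut_of_matrix (im_matrix f) = f"
proof
  fix x
  obtain r v where x: "form_real v" "x = r *\<^sub>R 1 + dec v" by (rule real_im_decomposition)
  show "aut_of_matrix (im_matrix f) x = f x"
    by (rule emb_eqI) (simp add: x emb_aut_of_matrix[OF im_matrix_real[OF f]] emb_add emb_scale_one
        emb_dec emb_aut_dec[OF f] linear_add[OF Aut_linear_mult_bij(1)[OF f]] Aut_scale_one[OF f])
qed

theorem algebra_Aut_iso_form_group: "(algebra_Aut :: ('a \<Rightarrow> 'a) monoid) \<cong> form_group"
proof (rule is_isoI, rule isoI)
  show "im_matrix \<in> hom algebra_Aut form_group"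
  proof (rule homI)
    fix f g :: "'a \<Rightarrow> 'a" assume f: "f \<in> carrier algebra_Aut" and g: "g \<in> carrier algebra_Aut"
    then have fg: "f \<otimes>\<^bsub>algebra_Aut\<^esub> g = f \<circ> g"
      by (auto simp: algebra_Aut_def BijGroup_def compose_def fun_eq_iff)
    have fg_Aut: "f \<circ> g \<in> carrier algebra_Aut"
      using f g by (auto simp: algebra_Aut_def Bij_def linear_compose bij_comp)
    have "im_matrix (f \<circ> g) = im_matrix f ** im_matrix g"
    proof (rule matrix_eqI_form_real)
      fix v assume v: "form_real v"
      have gv: "form_real (im_matrix g *v v)"
        using form_real_mult im_matrix_real[OF g] v by blast
      have "g (dec v) = dec (im_matrix g *v v)"
        by (rule emb_eqI) (simp add: emb_aut_dec[OF g v] emb_dec[OF gv])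
      then show "im_matrix (f \<circ> g) *v v = im_matrix f ** im_matrix g *v v"
        using emb_aut_dec[OF fg_Aut v] emb_aut_dec[OF f gv] by (simp add: matrix_vector_mul_assoc)
    qed
    then show "im_matrix (f \<otimes>\<^bsub>algebra_Aut\<^esub> g) = im_matrix f \<otimes>\<^bsub>form_group\<^esub> im_matrix g"
      by (simp add: fg) (simp add: form_group_def G2_complex_def)
  qed (rule im_matrix_in_form_group)
  show "bij_betw im_matrix (carrier algebra_Aut) (carrier form_group)"
    by (rule bij_betw_byWitness[where f' = aut_of_matrix])
      (auto simp: im_matrix_aut_of_matrix aut_of_matrix_im_matrix im_matrix_in_form_group aut_of_matrix_in_Aut)
qed

end


section \<open>Collineations fixing the square\<close>

lemma map_point_image_vertical:
  assumes "surj \<phi>"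
  shows "map_point \<phi> ` vertical_line c = vertical_line (\<phi> c)"
proof -
  have "{Affine (\<phi> c) y | y. True} = (\<lambda>y. Affine (\<phi> c) (\<phi> y)) ` UNIV"
    using assms by (auto simp: image_iff elim: surjE)
  moreover have "{Affine c y | y. True} = Affine c ` UNIV" by auto
  ultimately show ?thesis by (simp add: vertical_line_def image_image)
qed

lemma map_point_image_infinity:
  assumes "surj \<phi>"
  shows "map_point \<phi> ` line_at_infinity = line_at_infinity"
proof -
  have "map_point \<phi> ` range Slope = Slope ` range \<phi>" by (simp add: image_image)
  then show ?thesis using assms by (simp add: line_at_infinity_def)
qed

lemma map_point_image_sloped:
  assumes "surj \<phi>" "\<And>s x t. \<phi> (s * x + t) = \<phi> s * \<phi> x + \<phi> t"
  shows "map_point \<phi> ` sloped_line s t = sloped_line (\<phi> s) (\<phi> t)"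
proof
  show "sloped_line (\<phi> s) (\<phi> t) \<subseteq> map_point \<phi> ` sloped_line s t"
  proof
    fix p assume "p \<in> sloped_line (\<phi> s) (\<phi> t)"
    then consider "p = map_point \<phi> (Slope s)" | x where "p = Affine x (\<phi> s * x + \<phi> t)"
      by (auto simp: sloped_line_def)
    then show "p \<in> map_point \<phi> ` sloped_line s t"
    proof cases
      case 2
      obtain x' where "x = \<phi> x'" using assms(1) by (metis surjD)
      then have "p = map_point \<phi> (Affine x' (s * x' + t))" by (simp add: 2 assms)
      then show ?thesis unfolding sloped_line_def by blast
    qed (auto simp: sloped_line_def)
  qed
qed (auto simp: sloped_line_def assms)

lemma bij_map_point: "bij \<phi> \<Longrightarrow> bij (map_point \<phi>)"
  by (rule o_bij[of "map_point (inv_into UNIV \<phi>)"])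
    (simp_all add: fun_eq_iff point.map_comp o_def bij_is_inj bij_is_surj surj_f_inv_f point.map_ident)

text \<open>Recovers the coordinate map from the line at infinity, where each point carries a single
  scalar.\<close>

definition slope_map :: "('a point \<Rightarrow> 'a point) \<Rightarrow> 'a \<Rightarrow> 'a" where
  "slope_map f s = (case f (Slope s) of Slope s' \<Rightarrow> s' | _ \<Rightarrow> s)"

lemma slope_map_map_point [simp]: "slope_map (map_point \<phi>) = \<phi>"
  by (simp add: slope_map_def fun_eq_iff)

context octonion_form
begin

lemma map_point_in_Gamma:
  fixes \<phi> :: "'a \<Rightarrow> 'a"
  assumes "\<phi> \<in> carrier algebra_Aut"
  shows "map_point \<phi> \<in> carrier Gamma_square"
proof -
  note Aut_linear_mult_bij = Aut_linear_mult_bij[OF assms]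
  have surj: "surj \<phi>" using Aut_linear_mult_bij(3) by (rule bij_is_surj)
  have sloped: "map_point \<phi> ` sloped_line s t = sloped_line (\<phi> s) (\<phi> t)" for s t
    by (rule map_point_image_sloped[OF surj]) (simp add: Aut_linear_mult_bij(2) linear_add[OF Aut_linear_mult_bij(1)])
  have "collineation (map_point \<phi>)"
    unfolding collineation_def
  proof (intro conjI ballI bij_map_point Aut_linear_mult_bij(3))
    fix L :: "'a point set" assume "L \<in> plane_lines"
    then consider s t where "L = sloped_line s t" | c where "L = vertical_line c" | "L = line_at_infinity"
      by (auto simp: plane_lines_def)
    then show "map_point \<phi> ` L \<in> plane_lines"
      by cases (auto simp: plane_lines_def sloped map_point_image_vertical[OF surj]
        map_point_image_infinity[OF surj])
  qed
  then show ?thesis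
    by (simp add: Gamma_square_def Bij_def collineation_def square_def linear_0[OF Aut_linear_mult_bij(1)] Aut_one[OF assms])
qed

section \<open>Coordinates of a collineation fixing the square\<close>

lemma Gamma_coordinates:
  fixes f :: "'a point \<Rightarrow> 'a point"
  assumes f: "f \<in> carrier Gamma_square"
  obtains \<phi> where "f = map_point \<phi>" "bij \<phi>" "\<phi> 1 = 1" "\<And>s x t. \<phi> (s * x + t) = \<phi> s * \<phi> x + \<phi> t"
proof -
  have bij: "bij f" and lines: "\<And>L. L \<in> plane_lines \<Longrightarrow> f ` L \<in> plane_lines"
    and fixed: "f (Affine 0 0) = Affine 0 0" "f (Affine 1 1) = Affine 1 1"
      "f (Slope 0) = Slope 0" "f Infinity = Infinity"
    using f by (auto simp: Gamma_square_def collineation_def square_def)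
  have inj: "f p = f q \<longleftrightarrow> p = q" for p q
    using bij by (simp add: bij_def inj_eq)
  have Infinity_iff: "f p = Infinity \<longleftrightarrow> p = Infinity" for p
    using inj[of p Infinity] fixed by simp
  \<comment> \<open>Only the line at infinity contains both \<open>(0)\<close> and
    \<open>(\<infinity>)\<close>, which are fixed.\<close>
  have "f ` line_at_infinity = line_at_infinity"
  proof -
    have "f ` line_at_infinity \<in> plane_lines" by (rule lines) (simp add: plane_lines_def)
    moreover have "f (Slope 0) \<in> f ` line_at_infinity" "f Infinity \<in> f ` line_at_infinity"
      by (auto simp: line_at_infinity_def)
    ultimately show ?thesis
      by (auto simp: fixed plane_lines_def sloped_line_def vertical_line_def)
  qed
  then have at_infinity: "f p \<in> line_at_infinity \<longleftrightarrow> p \<in> line_at_infinity" for p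
    by (metis bij bij_is_inj inj_image_mem_iff)
  have slope: "\<exists>s'. f (Slope s) = Slope s'" for s
    using at_infinity[of "Slope s"] Infinity_iff[of "Slope s"] by (auto simp: line_at_infinity_def)
  have affine: "\<exists>x' y'. f (Affine x y) = Affine x' y'" for x y
    using at_infinity[of "Affine x y"] by (cases "f (Affine x y)") (auto simp: line_at_infinity_def)
  \<comment> \<open>The image contains \<open>(\<infinity>)\<close> and an affine point.\<close>
  have vertical: "\<exists>c'. f ` vertical_line c = vertical_line c'" for c
  proof -
    have "f ` vertical_line c \<in> plane_lines" by (rule lines) (simp add: plane_lines_def)
    moreover have "Infinity \<in> f ` vertical_line c"
      using fixed by (auto simp: vertical_line_def image_iff)
    moreover have "f (Affine c 0) \<in> f ` vertical_line c"
      by (auto simp: vertical_line_def)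
    then obtain x' y' where "Affine x' y' \<in> f ` vertical_line c" using affine by metis
    ultimately show ?thesis by (auto simp: plane_lines_def sloped_line_def line_at_infinity_def)
  qed
  have sloped: "\<exists>s' t'. f ` sloped_line s t = sloped_line s' t'" for s t
  proof -
    have "f ` sloped_line s t \<in> plane_lines" by (rule lines) (auto simp: plane_lines_def)
    moreover have "Infinity \<notin> f ` sloped_line s t"
      using Infinity_iff by (auto simp: sloped_line_def image_iff dest!: sym[of Infinity])
    ultimately show ?thesis by (auto simp: plane_lines_def vertical_line_def line_at_infinity_def)
  qed
  define a where "a x = (case f (Affine x 0) of Affine x' y' \<Rightarrow> x' | _ \<Rightarrow> 0)" for x
  define b where "b y = (case f (Affine 0 y) of Affine x' y' \<Rightarrow> y' | _ \<Rightarrow> 0)" for y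
  define \<phi> where "\<phi> = slope_map f"
  have Slope: "f (Slope s) = Slope (\<phi> s)" for s
    using slope[of s] by (auto simp: \<phi>_def slope_map_def)
  have Affine: "f (Affine x y) = Affine (a x) (b y)" for x y
  proof -
    obtain x' y' where xy: "f (Affine x y) = Affine x' y'" using affine by blast
    obtain u w where uw: "f (Affine x 0) = Affine u w" using affine by blast
    obtain v z where vz: "f (Affine 0 y) = Affine v z" using affine by blast
    \<comment> \<open>The vertical line through the point shows that the first coordinate of the
      image depends on \<open>x\<close> only.\<close>
    obtain c' where c': "f ` vertical_line x = vertical_line c'" using vertical by blast
    have "f (Affine x y) \<in> vertical_line c'" "f (Affine x 0) \<in> vertical_line c'"
      unfolding c'[symmetric] by (intro imageI, simp add: vertical_line_def)+
    then have "a x = x'" by (simp add: a_def xy uw vertical_line_def)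
    \<comment> \<open>Since \<open>(0)\<close> is fixed, horizontal lines stay horizontal, and the
      second coordinate depends on \<open>y\<close> only.\<close>
    obtain s' t' where st: "f ` sloped_line 0 y = sloped_line s' t'" using sloped by blast
    have "f (Slope 0) \<in> sloped_line s' t'" "f (Affine x y) \<in> sloped_line s' t'"
      "f (Affine 0 y) \<in> sloped_line s' t'"
      unfolding st[symmetric] by (intro imageI, simp add: sloped_line_def alg_mult_zero)+
    then have "b y = y'" by (simp add: b_def fixed xy vz sloped_line_def alg_mult_zero)
    show ?thesis using \<open>a x = x'\<close> \<open>b y = y'\<close> xy by simp
  qed
  have a0: "a 0 = 0" "a 1 = 1" "b 0 = 0" "b 1 = 1" "\<phi> 0 = 0"
    using fixed by (auto simp: Affine Slope)
  have line: "b (s * x + t) = \<phi> s * a x + b t" for s x t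
  proof -
    obtain s' t' where st: "f ` sloped_line s t = sloped_line s' t'" using sloped by blast
    have "f (Slope s) \<in> sloped_line s' t'" "f (Affine x (s * x + t)) \<in> sloped_line s' t'"
      "f (Affine 0 t) \<in> sloped_line s' t'"
      unfolding st[symmetric] by (intro imageI, simp add: sloped_line_def alg_mult_zero)+
    then show ?thesis by (simp add: Slope Affine sloped_line_def alg_mult_zero a0)
  qed
  \<comment> \<open>The points with \<open>x = 1\<close> on lines through the origin identify
    \<open>b\<close> with the slope map; the line of slope 1 then identifies \<open>a\<close> with
    \<open>b\<close>.\<close>
  have b_phi: "b = \<phi>"
    using line[of _ 1 0] by (auto simp: alg_mult_one a0)
  have phi1: "\<phi> 1 = 1" using a0 b_phi by simp
  have a_phi: "a = \<phi>"
    using line[of 1 _ 0] by (auto simp: alg_mult_one a0 b_phi phi1)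
  have f_eq: "f = map_point \<phi>"
  proof
    fix p show "f p = map_point \<phi> p"
      by (cases p) (simp_all add: Affine Slope fixed a_phi b_phi)
  qed
  have "inj \<phi>" using inj by (auto simp: inj_def f_eq) (metis point.map(2) point.inject(2))
  moreover have "surj \<phi>"
    unfolding surj_def
  proof
    fix y
    obtain p where "f p = Slope y" using bij by (metis bij_pointE)
    then show "\<exists>x. y = \<phi> x" by (cases p) (auto simp: f_eq)
  qed
  ultimately have "bij \<phi>" by (simp add: bij_def)
  then show thesis using that f_eq phi1 line by (metis a_phi b_phi)
qed

text \<open>If the imaginary part \<open>v\<close> commutes with \<open>e_j\<close>, then
  \<open>e_j \<times> v = 0\<close>, and the double cross product makes \<open>v\<close> a multiple
  of \<open>e_j\<close>. Two different values of \<open>j\<close> force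
  \<open>v = 0\<close>.\<close>

lemma central_imp_real:
  fixes z :: 'a
  assumes "\<And>y. z * y = y * z"
  obtains r where "z = r *\<^sub>R 1"
proof -
  obtain r v where z: "form_real v" "z = r *\<^sub>R 1 + dec v" by (rule real_im_decomposition)
  have "v = v $ j *s axis j 1" for j
  proof -
    have "emb (z * dec (axis j (\<omega> j))) = emb (dec (axis j (\<omega> j)) * z)" by (simp add: assms)
    then have "cross7 v (axis j (\<omega> j)) = cross7 (axis j (\<omega> j)) v"
      by (simp add: z emb_mult emb_add emb_scale_one emb_dec form_real_axis omult_def)
    then have "cross7 (axis j (\<omega> j)) v = - cross7 (axis j (\<omega> j)) v"
      using cross7_anticommute by metis
    then have "\<omega> j *s cross7 (axis j 1) v = 0"
      by (simp add: axis_eq_scale[of j "\<omega> j"] cross7_scale_left vec_eq_iff)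
    then have "cross7 (axis j 1) v = 0"
      using \<omega>_nonzero by (simp add: vec_eq_iff)
    then have "cross7 (axis j 1) (cross7 (axis j 1) v) = 0"
      using cross7_scale_right[of "axis j 1" 0 0] by simp
    then have "dot v (axis j 1) *s axis j 1 - dot (axis j 1) (axis j 1) *s v = 0"
      by (simp add: cross7_cross7 dot_commute)
    then show ?thesis by (simp add: dot_axis)
  qed
  note v = this
  have "v $ i = 0" for i
  proof (cases "i = 1")
    case True
    then show ?thesis using arg_cong[OF v[of 2], of "\<lambda>v. v $ i"] by (simp add: axis_def)
  next
    case False
    then show ?thesis using arg_cong[OF v[of 1], of "\<lambda>v. v $ i"] by (simp add: axis_def)
  qed
  then have "v = 0" by (simp add: vec_eq_iff)
  then have "emb z = emb (r *\<^sub>R 1)" using z by (simp add: emb_add emb_dec prod_eq_iff)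
  then show thesis using that emb_eqI by blast
qed

text \<open>By surjectivity central elements go to central elements, so the real scalars are mapped
  to real scalars by a ring endomorphism \<open>g\<close>, which is the identity.\<close>

lemma ring_automorphism_linear:
  fixes \<phi> :: "'a \<Rightarrow> 'a"
  assumes surj: "surj \<phi>" and add: "\<And>x y. \<phi> (x + y) = \<phi> x + \<phi> y"
    and mult: "\<And>x y. \<phi> (x * y) = \<phi> x * \<phi> y" and one: "\<phi> 1 = 1"
  shows "linear \<phi>"
proof -
  have "\<exists>s. \<phi> (r *\<^sub>R 1) = s *\<^sub>R 1" for r
  proof -
    have "r *\<^sub>R 1 * x = x * (r *\<^sub>R 1)" for x :: 'a
      by (rule emb_eqI) (simp add: emb_mult emb_scale_one omult_def dot_def
          cross7_scale_left[of 0 0, simplified] cross7_scale_right[of _ 0 0, simplified])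
    then have "\<phi> (r *\<^sub>R 1) * y = y * \<phi> (r *\<^sub>R 1)" for y
      using surj mult by (metis surjD)
    then show ?thesis using central_imp_real by blast
  qed
  then obtain g where g: "\<And>r. \<phi> (r *\<^sub>R 1) = g r *\<^sub>R 1" by metis
  have scale_inj: "r *\<^sub>R (1::'a) = s *\<^sub>R 1 \<Longrightarrow> r = s" for r s
    by (metis emb_scale_one fst_conv of_real_eq_iff)
  have "g r = r" for r
  proof (rule real_endomorphism_id)
    fix x y
    show "g (x + y) = g x + g y"
      by (rule scale_inj) (metis add g scaleR_add_left)
    show "g (x * y) = g x * g y"
      by (rule scale_inj) (metis mult g alg_scale_left alg_mult_one(1) scaleR_scaleR)
    show "g 1 = 1"
      by (rule scale_inj) (metis g one scaleR_one)
  qed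
  then have "\<phi> (r *\<^sub>R x) = r *\<^sub>R \<phi> x" for r x
    using mult[of "r *\<^sub>R 1" x] by (simp add: g alg_scale_left alg_mult_one)
  then show ?thesis by (intro linearI add)
qed

lemma Gamma_imp_aut:
  fixes f :: "'a point \<Rightarrow> 'a point"
  assumes "f \<in> carrier Gamma_square"
  obtains \<phi> where "f = map_point \<phi>" "\<phi> \<in> carrier algebra_Aut"
proof -
  obtain \<phi> where \<phi>: "f = map_point \<phi>" "bij \<phi>" "\<phi> 1 = 1"
    "\<And>s x t. \<phi> (s * x + t) = \<phi> s * \<phi> x + \<phi> t"
    using Gamma_coordinates[OF assms] by blast
  \<comment> \<open>The identity for lines, at slope 1 and zero arguments, reads
    \<open>\<phi> 0 = \<phi> 0 + \<phi> 0\<close>. Then \<open>t = 0\<close> yields multiplicativity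
    and \<open>s = 1\<close> additivity.\<close>
  have "\<phi> 0 = 0" using \<phi>(4)[of 1 0 0] by (simp add: alg_mult_zero alg_mult_one \<phi>(3))
  then have "\<phi> (s * x) = \<phi> s * \<phi> x" for s x using \<phi>(4)[of s x 0] by simp
  moreover have "\<phi> (x + y) = \<phi> x + \<phi> y" for x y
    using \<phi>(4)[of 1 x y] by (simp add: alg_mult_one \<phi>(3))
  ultimately have "\<phi> \<in> carrier algebra_Aut"
    using ring_automorphism_linear[of \<phi>] \<phi> by (simp add: algebra_Aut_def Bij_def bij_is_surj)
  then show thesis using that \<phi> by blast
qed

theorem Gamma_square_iso_algebra_Aut:
  "(Gamma_square :: ('a point \<Rightarrow> 'a point) monoid) \<cong> (algebra_Aut :: ('a \<Rightarrow> 'a) monoid)"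
proof (rule is_isoI, rule isoI)
  show "slope_map \<in> hom (Gamma_square :: ('a point \<Rightarrow> 'a point) monoid) algebra_Aut"
  proof (rule homI)
    fix f g :: "'a point \<Rightarrow> 'a point"
    assume "f \<in> carrier Gamma_square" "g \<in> carrier Gamma_square"
    then obtain \<phi> \<psi> where f: "f = map_point \<phi>" "\<phi> \<in> carrier algebra_Aut"
      and g: "g = map_point \<psi>" "\<psi> \<in> carrier algebra_Aut"
      by (metis Gamma_imp_aut)
    have "f \<otimes>\<^bsub>Gamma_square\<^esub> g = map_point (\<phi> \<circ> \<psi>)"
      using Aut_linear_mult_bij(3)[OF f(2)] Aut_linear_mult_bij(3)[OF g(2)]
      by (simp add: f g Gamma_square_def BijGroup_def Bij_def compose_def bij_map_point
          point.map_comp fun_eq_iff)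
    moreover have "\<phi> \<otimes>\<^bsub>algebra_Aut\<^esub> \<psi> = \<phi> \<circ> \<psi>"
      using Aut_linear_mult_bij(3)[OF f(2)] Aut_linear_mult_bij(3)[OF g(2)]
      by (simp add: algebra_Aut_def BijGroup_def Bij_def compose_def fun_eq_iff)
    ultimately show "slope_map (f \<otimes>\<^bsub>Gamma_square\<^esub> g) = slope_map f \<otimes>\<^bsub>algebra_Aut\<^esub> slope_map g"
      by (simp add: f g)
  qed (auto elim: Gamma_imp_aut)
  show "bij_betw slope_map (carrier (Gamma_square :: ('a point \<Rightarrow> 'a point) monoid)) (carrier algebra_Aut)"
    by (rule bij_betw_byWitness[where f' = map_point])
      (auto simp: map_point_in_Gamma elim: Gamma_imp_aut)
qed

end


section \<open>Octonions and split octonions\<close>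

lemma range_coordinates:
  assumes "\<And>i. \<omega> i \<noteq> 0" "\<And>a u. \<exists>x. f x = (complex_of_real a, \<chi> i::7. \<omega> i * complex_of_real (u $ i))"
    "\<And>x. \<exists>a u. f x = (complex_of_real a, \<chi> i. \<omega> i * complex_of_real (u $ i))"
  shows "range f = {(a, v). a \<in> \<real> \<and> (\<forall>i. v $ i / \<omega> i \<in> \<real>)}"
proof -
  have sup: "(a, v) \<in> range f" if a: "a \<in> \<real>" and v: "\<forall>i. v $ i / \<omega> i \<in> \<real>" for a v
  proof -
    obtain x where x: "f x = (of_real (Re a), \<chi> i. \<omega> i * of_real ((\<chi> i. Re (v $ i / \<omega> i)) $ i))"
      using assms(2) by blast
    have "\<omega> i * of_real (Re (v $ i / \<omega> i)) = v $ i" for i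
      using v assms(1)[of i] by simp
    then have "f x = (a, v)" using a by (simp add: x vec_eq_iff)
    then show ?thesis by (metis rangeI)
  qed
  have sub: "fst (f x) \<in> \<real> \<and> (\<forall>i. snd (f x) $ i / \<omega> i \<in> \<real>)" for x
  proof -
    obtain a u where "f x = (complex_of_real a, \<chi> i. \<omega> i * complex_of_real (u $ i))"
      using assms(3) by blast
    then show ?thesis using assms(1) by simp
  qed
  show ?thesis
  proof (intro equalityI subsetI)
    fix p :: "complex \<times> (complex^7)" assume "p \<in> {(a, v). a \<in> \<real> \<and> (\<forall>i. v $ i / \<omega> i \<in> \<real>)}"
    then show "p \<in> range f" by (cases p) (simp add: sup)
  next
    fix p :: "complex \<times> (complex^7)" assume "p \<in> range f"
    then obtain x where "p = f x" by blast
    then show "p \<in> {(a, v). a \<in> \<real> \<and> (\<forall>i. v $ i / \<omega> i \<in> \<real>)}"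
      using sub[of x] by (simp add: split_def)
  qed
qed

section \<open>Coordinates for the two algebras\<close>

definition vector7 :: "'a \<Rightarrow> 'a \<Rightarrow> 'a \<Rightarrow> 'a \<Rightarrow> 'a \<Rightarrow> 'a \<Rightarrow> 'a \<Rightarrow> 'a^7" where
  "vector7 a b c d e f g = (\<chi> i. if i = 1 then a else if i = 2 then b else if i = 3 then c
     else if i = 4 then d else if i = 5 then e else if i = 6 then f else g)"

lemma vector7_nth [simp]:
  "vector7 a b c d e f g $ 1 = a" "vector7 a b c d e f g $ 2 = b" "vector7 a b c d e f g $ 3 = c"
  "vector7 a b c d e f g $ 4 = d" "vector7 a b c d e f g $ 5 = e" "vector7 a b c d e f g $ 6 = f"
  "vector7 a b c d e f g $ 7 = g"
  by (simp_all add: vector7_def)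

text \<open>
  The order of the coordinates and the sign of the last one match the multiplication with the
  signs of the seven terms of \<open>G2_form\<close>.
\<close>

fun real_coords :: "quaternion \<Rightarrow> quaternion \<Rightarrow> real \<times> (real^7)" where
  "real_coords (Quat a b) (Quat c d) = (Re a, vector7 (Im a) (Re b) (Im b) (Re c) (Im c) (Re d) (- Im d))"

fun emb_oct :: "octonion \<Rightarrow> complex \<times> (complex^7)" where
  "emb_oct (Oct p q) = (of_real (fst (real_coords p q)), \<chi> i. of_real (snd (real_coords p q) $ i))"

text \<open>The split octonion \<open>SOct p q\<close> becomes \<open>p + \<i> q\<close> in the
  complexified octonions: the factor \<open>\<i> * \<i> = -1\<close> reverses the sign of the term
  \<open>qcnj d * b\<close>.\<close>

definition split_unit :: "7 \<Rightarrow> complex" where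
  "split_unit i = (if i \<in> {1, 2, 3} then 1 else \<i>)"

fun emb_soct :: "split_octonion \<Rightarrow> complex \<times> (complex^7)" where
  "emb_soct (SOct p q) = (of_real (fst (real_coords p q)),
     \<chi> i. split_unit i * of_real (snd (real_coords p q) $ i))"

lemma real_coords_surj: "\<exists>p q. real_coords p q = (a, u)"
proof -
  have "real_coords (Quat (Complex a (u$1)) (Complex (u$2) (u$3)))
      (Quat (Complex (u$4) (u$5)) (Complex (u$6) (- u$7))) = (a, u)"
    by (simp add: vec_eq_iff forall_7)
  then show ?thesis by blast
qed

lemma real_coords_inj: "real_coords p q = real_coords p' q' \<Longrightarrow> p = p' \<and> q = q'"
  by (cases p; cases q; cases p'; cases q') (simp add: vec_eq_iff forall_7 complex_eq_iff)

interpretation oct: octonion_form emb_oct "\<lambda>_. 1"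
proof
  show "inj emb_oct"
  proof (rule injI)
    fix x y assume "emb_oct x = emb_oct y"
    then show "x = y" by (cases x; cases y) (simp add: vec_eq_iff real_coords_inj prod_eq_iff)
  qed
  show "emb_oct (x + y) = emb_oct x + emb_oct y" for x y
    by (cases x rule: emb_oct.cases; cases y rule: emb_oct.cases)
       (rename_tac p q p' q'; case_tac p; case_tac q; case_tac p'; case_tac q';
        simp add: vec_eq_iff forall_7)
  show "emb_oct (r *\<^sub>R x) = pscale (of_real r) (emb_oct x)" for r x
    by (cases x rule: emb_oct.cases)
       (rename_tac p q; case_tac p; case_tac q; simp add: vec_eq_iff forall_7 pscale_def)
  show "emb_oct 1 = (1, 0)"
    by (simp add: one_octonion_def one_quaternion_def zero_quaternion_def vec_eq_iff forall_7)
  show "emb_oct (x * y) = omult (emb_oct x) (emb_oct y)" for x y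
  proof -
    obtain a b c d a' b' c' d' where xy: "x = Oct (Quat a b) (Quat c d)" "y = Oct (Quat a' b') (Quat c' d')"
      by (metis octonion.exhaust quaternion.exhaust)
    show ?thesis unfolding xy
      apply (simp add: vec_eq_iff forall_7 omult_def)
      apply (simp only: cross7_nth dot_def sum_7)
      apply (simp only: vec_lambda_beta vector7_nth snd_conv fst_conv)
      apply (intro conjI; simp add: complex_eq_iff)
      done
  qed
  show "range emb_oct = {(a, v). a \<in> \<real> \<and> (\<forall>i. v $ i / 1 \<in> \<real>)}"
  proof (rule range_coordinates)
    show "\<exists>x. emb_oct x = (complex_of_real a, \<chi> i. 1 * complex_of_real (u $ i))" for a u
    proof -
      obtain p q where "real_coords p q = (a, u)" using real_coords_surj by blast
      then have "emb_oct (Oct p q) = (complex_of_real a, \<chi> i. 1 * complex_of_real (u $ i))" by simp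
      then show ?thesis by blast
    qed
    show "\<exists>a u. emb_oct x = (complex_of_real a, \<chi> i. 1 * complex_of_real (u $ i))" for x
      by (cases x) (simp, blast)
  qed simp
qed simp_all

interpretation split: octonion_form emb_soct split_unit
proof
  have ne: "split_unit i \<noteq> 0" for i by (simp add: split_unit_def)
  then show "split_unit i \<noteq> 0" for i .
  show "split_unit i * split_unit i \<in> \<real>" for i by (simp add: split_unit_def)
  have u: "split_unit 1 = 1" "split_unit 2 = 1" "split_unit 3 = 1" "split_unit 4 = \<i>"
    "split_unit 5 = \<i>" "split_unit 6 = \<i>" "split_unit 7 = \<i>"
    by (simp_all add: split_unit_def)
  show "inj emb_soct"
  proof (rule injI)
    fix x y assume "emb_soct x = emb_soct y"
    then show "x = y" by (cases x; cases y) (simp add: vec_eq_iff real_coords_inj prod_eq_iff ne)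
  qed
  show "emb_soct (x + y) = emb_soct x + emb_soct y" for x y
    by (cases x rule: emb_soct.cases; cases y rule: emb_soct.cases)
       (rename_tac p q p' q'; case_tac p; case_tac q; case_tac p'; case_tac q';
        simp add: vec_eq_iff forall_7 algebra_simps)
  show "emb_soct (r *\<^sub>R x) = pscale (of_real r) (emb_soct x)" for r x
    by (cases x rule: emb_soct.cases)
       (rename_tac p q; case_tac p; case_tac q; simp add: vec_eq_iff forall_7 pscale_def)
  show "emb_soct 1 = (1, 0)"
    by (simp add: one_split_octonion_def one_quaternion_def zero_quaternion_def vec_eq_iff forall_7)
  show "emb_soct (x * y) = omult (emb_soct x) (emb_soct y)" for x y
  proof -
    obtain a b c d a' b' c' d' where xy: "x = SOct (Quat a b) (Quat c d)" "y = SOct (Quat a' b') (Quat c' d')"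
      by (metis split_octonion.exhaust quaternion.exhaust)
    show ?thesis unfolding xy
      apply (simp add: vec_eq_iff forall_7 omult_def u)
      apply (simp only: cross7_nth dot_def sum_7)
      apply (simp only: vec_lambda_beta vector7_nth snd_conv fst_conv u)
      apply (intro conjI; simp add: complex_eq_iff)
      done
  qed
  show "range emb_soct = {(a, v). a \<in> \<real> \<and> (\<forall>i. v $ i / split_unit i \<in> \<real>)}"
  proof (rule range_coordinates)
    show "\<exists>x. emb_soct x = (complex_of_real a, \<chi> i. split_unit i * complex_of_real (u $ i))" for a u
    proof -
      obtain p q where "real_coords p q = (a, u)" using real_coords_surj by blast
      then have "emb_soct (SOct p q) = (complex_of_real a, \<chi> i. split_unit i * complex_of_real (u $ i))" by simp
      then show ?thesis by blast
    qed
    show "\<exists>a u. emb_soct x = (complex_of_real a, \<chi> i. split_unit i * complex_of_real (u $ i))" for x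
      by (cases x) (simp, blast)
  qed (rule ne)
qed

section \<open>Identification with the real forms of G2\<close>

lemma form_group_oct: "oct.form_group = G2_compact"
  unfolding oct.form_group_def G2_compact_def real_form_def
  by (intro arg_cong[where f="\<lambda>C. G2_complex\<lparr>carrier := C\<rparr>"])
     (auto simp: conj_matrix_def vec_eq_iff Reals_cnj_iff)

lemma involution_conj_nth:
  "(involution_matrix ** conj_matrix A ** involution_matrix) $ i $ j =
    (if i \<in> {1, 2, 3} then 1 else - 1) * cnj (A $ i $ j) * (if j \<in> {1, 2, 3} then 1 else - 1)"
  unfolding matrix_matrix_mult_def involution_matrix_def conj_matrix_def
  by (simp add: if_distrib[of "\<lambda>a. a * _"] if_distrib[of "\<lambda>a. _ * a"] cong: if_cong)

text \<open>Split the indices into \<open>{1, 2, 3}\<close> and the rest. Both conditions say that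
  entries within a block are real and entries across blocks are purely imaginary.\<close>

lemma form_group_split: "split.form_group = G2_split"
proof -
  have "A $ i $ j * split_unit j / split_unit i \<in> \<real> \<longleftrightarrow>
      (involution_matrix ** conj_matrix A ** involution_matrix) $ i $ j = A $ i $ j" for A i j
    unfolding involution_conj_nth split_unit_def
    by (auto simp: Reals_cnj_iff complex_is_Real_iff complex_eq_iff)
  then show ?thesis
    unfolding split.form_group_def G2_split_def real_form_def by (simp add: vec_eq_iff)
qed

theorem corollary1:
  shows "(Gamma_square :: (octonion point \<Rightarrow> octonion point) monoid)
           \<cong> (algebra_Aut :: (octonion \<Rightarrow> octonion) monoid)
       \<and> (Gamma_square :: (octonion point \<Rightarrow> octonion point) monoid) \<cong> G2_compact
       \<and> (Gamma_square :: (split_octonion point \<Rightarrow> split_octonion point) monoid) \<cong> G2_split"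
  using oct.Gamma_square_iso_algebra_Aut split.Gamma_square_iso_algebra_Aut
    oct.algebra_Aut_iso_form_group split.algebra_Aut_iso_form_group
  unfolding form_group_oct form_group_split by (blast intro: iso_trans)

end
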